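(* Let $A$ be a differential algebra over $\mathbb F$ and let $d:A\to\Omega(A)$ be its space of Kähler differentials. For every left $A[\partial]$-module $M$ and every derivation $\delta:A\to M$ commuting with $\partial$, there exists a unique homomorphism of left $A[\partial]$-modules $\widetilde\delta:\Omega(A)\to M$ such that $\widetilde\delta\circ d=\delta$. Equivalently, for every left $A[\partial]$-module $M$ there is a canonical vector space isomorphism $$\mathrm{Der}^\partial(A,M)\simeq\mathrm{Hom}_{A[\partial]}(\Omega(A),M),$$ where $\mathrm{Der}^\partial(A,M)$ is the space of derivations from $A$ to $M$ commuting with $\partial$ and $\mathrm{Hom}_{A[\partial]}(\Omega(A),M)$ is the space of left $A[\partial]$-module homomorphisms from $\Omega(A)$ to $M$.
   Context: $\mathbb F$ is a field of characteristic $0$. A differential algebra $A$ is a commutative associative unital algebra with a derivation $\partial:A\to A$; $A[\partial]$ is the associative algebra of polynomial differential operators $\sum_ia_i\partial^i$ with product given by composition. A derivation $\delta:A\to M$ is a linear map with $\delta(fg)=f\delta(g)+g\delta(f)$. $\Omega(A)$ is the $A$-module generated by symbols $da$, $a\in A$, modulo the relations expressing linearity of $d$ and $d(ab)=a\,db+b\,da$; it is a left $A[\partial]$-module with $\partial(a\,db)=(\partial a)db+a\,d(\partial b)$. *)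

theory Defs
  imports "HOL-Algebra.UnivPoly"
begin

section \<open>Left modules over arbitrary rings\<close>

text \<open>The locale \<^locale>\<open>module\<close> requires a commutative ring of scalars; here \<open>R\<close> is any ring.\<close>

locale left_module = R?: ring R + M?: abelian_group M for R :: "('r, 'x) ring_scheme" (structure)
    and M :: "('r, 'm, 'y) module_scheme" (structure) +
  assumes smult_closed [simp, intro]:
      "\<lbrakk>a \<in> carrier R; x \<in> carrier M\<rbrakk> \<Longrightarrow> a \<odot>\<^bsub>M\<^esub> x \<in> carrier M"
    and smult_l_distr:
      "\<lbrakk>a \<in> carrier R; b \<in> carrier R; x \<in> carrier M\<rbrakk> \<Longrightarrow>
        (a \<oplus>\<^bsub>R\<^esub> b) \<odot>\<^bsub>M\<^esub> x = a \<odot>\<^bsub>M\<^esub> x \<oplus>\<^bsub>M\<^esub> b \<odot>\<^bsub>M\<^esub> x"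
    and smult_r_distr:
      "\<lbrakk>a \<in> carrier R; x \<in> carrier M; y \<in> carrier M\<rbrakk> \<Longrightarrow>
        a \<odot>\<^bsub>M\<^esub> (x \<oplus>\<^bsub>M\<^esub> y) = a \<odot>\<^bsub>M\<^esub> x \<oplus>\<^bsub>M\<^esub> a \<odot>\<^bsub>M\<^esub> y"
    and smult_assoc:
      "\<lbrakk>a \<in> carrier R; b \<in> carrier R; x \<in> carrier M\<rbrakk> \<Longrightarrow>
        (a \<otimes>\<^bsub>R\<^esub> b) \<odot>\<^bsub>M\<^esub> x = a \<odot>\<^bsub>M\<^esub> (b \<odot>\<^bsub>M\<^esub> x)"
    and smult_one [simp]: "x \<in> carrier M \<Longrightarrow> \<one>\<^bsub>R\<^esub> \<odot>\<^bsub>M\<^esub> x = x"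

locale left_module_hom = M?: left_module R M + N?: left_module R N
  for R :: "('r, 'x) ring_scheme" (structure)
    and M :: "('r, 'm, 'y) module_scheme" (structure)
    and N :: "('r, 'n, 'z) module_scheme" (structure) +
  fixes f :: "'m \<Rightarrow> 'n"
  assumes hom_closed: "f \<in> carrier M \<rightarrow> carrier N"
    and hom_add: "\<lbrakk>x \<in> carrier M; y \<in> carrier M\<rbrakk> \<Longrightarrow> f (x \<oplus>\<^bsub>M\<^esub> y) = f x \<oplus>\<^bsub>N\<^esub> f y"
    and hom_smult: "\<lbrakk>a \<in> carrier R; x \<in> carrier M\<rbrakk> \<Longrightarrow> f (a \<odot>\<^bsub>M\<^esub> x) = a \<odot>\<^bsub>N\<^esub> f x"

locale left_module_iso = left_module_hom +
  assumes bij: "bij_betw f (carrier M) (carrier N)"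

text \<open>In the module records below, the fields \<^const>\<open>mult\<close> and \<^const>\<open>one\<close> are irrelevant.\<close>

definition regular_module :: "('a, 'x) ring_scheme \<Rightarrow> ('a, 'a) module" where
  "regular_module R = \<lparr>carrier = carrier R, mult = mult R, one = one R, zero = zero R,
     add = add R, smult = mult R\<rparr>"

definition restrict_scalars ::
  "('s \<Rightarrow> 'r) \<Rightarrow> ('r, 'm, 'x) module_scheme \<Rightarrow> ('s, 'm) module" where
  "restrict_scalars h M = \<lparr>carrier = carrier M, mult = mult M, one = one M, zero = zero M,
     add = add M, smult = (\<lambda>s x. h s \<odot>\<^bsub>M\<^esub> x)\<rparr>"

text \<open>A set \<open>S\<close> of functions from \<open>X\<close> to the carrier of \<open>V\<close>, with pointwise operations.
  Functions are taken to be extensional, so that equality in \<open>S\<close> is equality on \<open>X\<close>.\<close>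

definition function_module ::
  "('x \<Rightarrow> 'v) set \<Rightarrow> 'x set \<Rightarrow> ('s, 'v, 'z) module_scheme \<Rightarrow> ('s, 'x \<Rightarrow> 'v) module" where
  "function_module S X V = \<lparr>carrier = {f \<in> S. f \<in> extensional X}, mult = undefined, one = undefined,
     zero = (\<lambda>x\<in>X. \<zero>\<^bsub>V\<^esub>), add = (\<lambda>f g. \<lambda>x\<in>X. f x \<oplus>\<^bsub>V\<^esub> g x),
     smult = (\<lambda>c f. \<lambda>x\<in>X. c \<odot>\<^bsub>V\<^esub> f x)\<rparr>"


section \<open>Derivations and differential algebras\<close>

text \<open>Here \<open>A\<close> is an \<open>F\<close>-algebra and \<open>N\<close> an \<open>A\<close>-module; a scalar \<open>c\<close> of \<open>F\<close> acts on \<open>N\<close> as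
  \<open>c \<odot> \<one> \<in> A\<close>.\<close>

definition derivation ::
  "('f, 'x) ring_scheme \<Rightarrow> ('f, 'a, 'y) module_scheme \<Rightarrow> ('a, 'n, 'z) module_scheme \<Rightarrow>
    ('a \<Rightarrow> 'n) \<Rightarrow> bool" where
  "derivation F A N \<delta> \<longleftrightarrow>
     \<delta> \<in> carrier A \<rightarrow> carrier N \<and>
     (\<forall>a\<in>carrier A. \<forall>b\<in>carrier A. \<delta> (a \<oplus>\<^bsub>A\<^esub> b) = \<delta> a \<oplus>\<^bsub>N\<^esub> \<delta> b) \<and>
     (\<forall>c\<in>carrier F. \<forall>a\<in>carrier A. \<delta> (c \<odot>\<^bsub>A\<^esub> a) = (c \<odot>\<^bsub>A\<^esub> \<one>\<^bsub>A\<^esub>) \<odot>\<^bsub>N\<^esub> \<delta> a) \<and>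
     (\<forall>a\<in>carrier A. \<forall>b\<in>carrier A. \<delta> (a \<otimes>\<^bsub>A\<^esub> b) = a \<odot>\<^bsub>N\<^esub> \<delta> b \<oplus>\<^bsub>N\<^esub> b \<odot>\<^bsub>N\<^esub> \<delta> a)"

locale differential_algebra = F?: field F + A?: algebra F A
  for F (structure) and A (structure) +
  fixes D
  assumes char_0: "\<And>n::nat. n > 0 \<Longrightarrow> [n] \<cdot>\<^bsub>F\<^esub> \<one>\<^bsub>F\<^esub> \<noteq> \<zero>\<^bsub>F\<^esub>"
    and D_derivation: "derivation F A (regular_module A) D"


section \<open>The algebra of polynomial differential operators\<close>

text \<open>The elements are formal polynomials \<open>\<Sum>\<^sub>i a\<^sub>i \<partial>\<^sup>i\<close> with coefficients written on the left, so
  the underlying left \<open>A\<close>-module is that of \<^term>\<open>UP A\<close>. Left composition with \<open>\<partial>\<close> is determined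
  by \<open>\<partial> \<circ> b\<partial>\<^sup>j = (\<partial>b)\<partial>\<^sup>j + b\<partial>\<^sup>j\<^sup>+\<^sup>1\<close>, and \<open>(\<Sum>\<^sub>i a\<^sub>i \<partial>\<^sup>i) \<circ> q = \<Sum>\<^sub>i a\<^sub>i (\<partial>\<^sup>i \<circ> q)\<close>.\<close>

definition partial_comp ::
  "('f, 'a, 'x) module_scheme \<Rightarrow> ('a \<Rightarrow> 'a) \<Rightarrow> (nat \<Rightarrow> 'a) \<Rightarrow> (nat \<Rightarrow> 'a)" where
  "partial_comp A D q = (\<lambda>j. D (q j) \<oplus>\<^bsub>A\<^esub> (if j = 0 then \<zero>\<^bsub>A\<^esub> else q (j - 1)))"

definition diff_ops ::
  "('f, 'a, 'x) module_scheme \<Rightarrow> ('a \<Rightarrow> 'a) \<Rightarrow> ('a, nat \<Rightarrow> 'a) up_ring" where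
  "diff_ops A D = (UP A)\<lparr>mult :=
     (\<lambda>p q. \<Oplus>\<^bsub>UP A\<^esub>i\<in>{..deg A p}. p i \<odot>\<^bsub>UP A\<^esub> (partial_comp A D ^^ i) q)\<rparr>"

text \<open>A left \<open>A[\<partial>]\<close>-module as a module over \<open>A\<close> and over \<open>F\<close>.\<close>

definition as_A_module ::
  "('f, 'a, 'x) module_scheme \<Rightarrow> ('a \<Rightarrow> 'a) \<Rightarrow> (nat \<Rightarrow> 'a, 'm, 'y) module_scheme \<Rightarrow> ('a, 'm) module"
  where "as_A_module A D = restrict_scalars (\<lambda>a. monom (diff_ops A D) a 0)"

definition as_F_module ::
  "('f, 'a, 'x) module_scheme \<Rightarrow> ('a \<Rightarrow> 'a) \<Rightarrow> (nat \<Rightarrow> 'a, 'm, 'y) module_scheme \<Rightarrow> ('f, 'm) module"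
  where "as_F_module A D = restrict_scalars (\<lambda>c. monom (diff_ops A D) (c \<odot>\<^bsub>A\<^esub> \<one>\<^bsub>A\<^esub>) 0)"

definition partial_derivation ::
  "('f, 'z) ring_scheme \<Rightarrow> ('f, 'a, 'x) module_scheme \<Rightarrow> ('a \<Rightarrow> 'a) \<Rightarrow>
    (nat \<Rightarrow> 'a, 'm, 'y) module_scheme \<Rightarrow> ('a \<Rightarrow> 'm) \<Rightarrow> bool" where
  "partial_derivation F A D M \<delta> \<longleftrightarrow>
     derivation F A (as_A_module A D M) \<delta> \<and>
     (\<forall>a\<in>carrier A. \<delta> (D a) = monom (diff_ops A D) \<one>\<^bsub>A\<^esub> 1 \<odot>\<^bsub>M\<^esub> \<delta> a)"


section \<open>Kaehler differentials\<close>

text \<open>The free \<open>A\<close>-module on symbols \<open>[b]\<close>, \<open>b \<in> A\<close>: finitely supported coefficient functions.\<close>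

definition free_module :: "('f, 'a, 'x) module_scheme \<Rightarrow> ('a, 'a \<Rightarrow> 'a) module" where
  "free_module A = \<lparr>
     carrier = {u. (\<forall>b. u b \<in> carrier A) \<and> (\<forall>b. b \<notin> carrier A \<longrightarrow> u b = \<zero>\<^bsub>A\<^esub>) \<and>
                   finite {b. u b \<noteq> \<zero>\<^bsub>A\<^esub>}},
     mult = undefined, one = undefined,
     zero = (\<lambda>b. \<zero>\<^bsub>A\<^esub>), add = (\<lambda>u v b. u b \<oplus>\<^bsub>A\<^esub> v b), smult = (\<lambda>a u b. a \<otimes>\<^bsub>A\<^esub> u b)\<rparr>"

text \<open>\<open>free_term A a b\<close> is \<open>a[b]\<close>.\<close>

definition free_term :: "('f, 'a, 'x) module_scheme \<Rightarrow> 'a \<Rightarrow> 'a \<Rightarrow> 'a \<Rightarrow> 'a" where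
  "free_term A a b = (\<lambda>x. if x = b then a else \<zero>\<^bsub>A\<^esub>)"

abbreviation free_gen :: "('f, 'a, 'x) module_scheme \<Rightarrow> 'a \<Rightarrow> 'a \<Rightarrow> 'a" where
  "free_gen A b \<equiv> free_term A \<one>\<^bsub>A\<^esub> b"

definition kaehler_rels ::
  "('f, 'y) ring_scheme \<Rightarrow> ('f, 'a, 'x) module_scheme \<Rightarrow> ('a \<Rightarrow> 'a) set" where
  "kaehler_rels F A =
     {free_gen A (a \<oplus>\<^bsub>A\<^esub> b) \<ominus>\<^bsub>free_module A\<^esub> (free_gen A a \<oplus>\<^bsub>free_module A\<^esub> free_gen A b) | a b.
        a \<in> carrier A \<and> b \<in> carrier A} \<union>
     {free_gen A (c \<odot>\<^bsub>A\<^esub> a) \<ominus>\<^bsub>free_module A\<^esub> free_term A (c \<odot>\<^bsub>A\<^esub> \<one>\<^bsub>A\<^esub>) a | c a.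
        c \<in> carrier F \<and> a \<in> carrier A} \<union>
     {free_gen A (a \<otimes>\<^bsub>A\<^esub> b) \<ominus>\<^bsub>free_module A\<^esub> (free_term A a b \<oplus>\<^bsub>free_module A\<^esub> free_term A b a) | a b.
        a \<in> carrier A \<and> b \<in> carrier A}"

definition kaehler_sub ::
  "('f, 'y) ring_scheme \<Rightarrow> ('f, 'a, 'x) module_scheme \<Rightarrow> ('a \<Rightarrow> 'a) set" where
  "kaehler_sub F A = \<Inter>{N. submodule N A (free_module A) \<and> kaehler_rels F A \<subseteq> N}"

text \<open>The quotient \<open>A\<close>-module. A map \<open>h\<close> on representatives induces \<open>X \<mapsto> \<Union>x\<in>X. N +> h x\<close> on
  cosets of \<open>N\<close> (a single coset precisely when \<open>h\<close> is compatible with \<open>N\<close>).\<close>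

definition kaehler ::
  "('f, 'y) ring_scheme \<Rightarrow> ('f, 'a, 'x) module_scheme \<Rightarrow> ('a, ('a \<Rightarrow> 'a) set) module" where
  "kaehler F A = \<lparr>
     carrier = a_rcosets\<^bsub>free_module A\<^esub> (kaehler_sub F A),
     mult = undefined, one = undefined,
     zero = kaehler_sub F A, add = set_add (free_module A),
     smult = (\<lambda>a X. \<Union>x\<in>X. kaehler_sub F A +>\<^bsub>free_module A\<^esub> (a \<odot>\<^bsub>free_module A\<^esub> x))\<rparr>"

definition kaehler_d ::
  "('f, 'y) ring_scheme \<Rightarrow> ('f, 'a, 'x) module_scheme \<Rightarrow> 'a \<Rightarrow> ('a \<Rightarrow> 'a) set" where
  "kaehler_d F A a = kaehler_sub F A +>\<^bsub>free_module A\<^esub> free_gen A a"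

text \<open>\<open>\<partial>(a[b]) = (\<partial>a)[b] + a[\<partial>b]\<close> on the free module, and the induced map \<open>\<partial>\<close> on the quotient.\<close>

definition free_partial ::
  "('f, 'a, 'x) module_scheme \<Rightarrow> ('a \<Rightarrow> 'a) \<Rightarrow> ('a \<Rightarrow> 'a) \<Rightarrow> ('a \<Rightarrow> 'a)" where
  "free_partial A D u =
     (\<Oplus>\<^bsub>free_module A\<^esub>b\<in>{b. u b \<noteq> \<zero>\<^bsub>A\<^esub>}.
        free_term A (D (u b)) b \<oplus>\<^bsub>free_module A\<^esub> free_term A (u b) (D b))"

definition kaehler_partial ::
  "('f, 'y) ring_scheme \<Rightarrow> ('f, 'a, 'x) module_scheme \<Rightarrow> ('a \<Rightarrow> 'a) \<Rightarrow>
    ('a \<Rightarrow> 'a) set \<Rightarrow> ('a \<Rightarrow> 'a) set" where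
  "kaehler_partial F A D X = (\<Union>x\<in>X. kaehler_sub F A +>\<^bsub>free_module A\<^esub> free_partial A D x)"

text \<open>\<open>\<Omega>(A)\<close> as a left \<open>A[\<partial>]\<close>-module: \<open>\<Sum>\<^sub>i a\<^sub>i \<partial>\<^sup>i\<close> sends \<open>\<omega>\<close> to \<open>\<Sum>\<^sub>i a\<^sub>i (\<partial>\<^sup>i \<omega>)\<close>.\<close>

definition Omega ::
  "('f, 'y) ring_scheme \<Rightarrow> ('f, 'a, 'x) module_scheme \<Rightarrow> ('a \<Rightarrow> 'a) \<Rightarrow>
    (nat \<Rightarrow> 'a, ('a \<Rightarrow> 'a) set) module" where
  "Omega F A D = \<lparr>
     carrier = carrier (kaehler F A), mult = undefined, one = undefined,
     zero = zero (kaehler F A), add = add (kaehler F A),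
     smult = (\<lambda>p X. \<Oplus>\<^bsub>kaehler F A\<^esub>i\<in>{..deg A p}.
                p i \<odot>\<^bsub>kaehler F A\<^esub> (kaehler_partial F A D ^^ i) X)\<rparr>"


section \<open>The spaces of derivations and of homomorphisms\<close>

definition Der ::
  "('f, 'y) ring_scheme \<Rightarrow> ('f, 'a, 'x) module_scheme \<Rightarrow> ('a \<Rightarrow> 'a) \<Rightarrow>
    (nat \<Rightarrow> 'a, 'm, 'z) module_scheme \<Rightarrow> ('f, 'a \<Rightarrow> 'm) module" where
  "Der F A D M =
     function_module {\<delta>. partial_derivation F A D M \<delta>} (carrier A) (as_F_module A D M)"

definition Hom ::
  "('f, 'a, 'x) module_scheme \<Rightarrow> ('a \<Rightarrow> 'a) \<Rightarrow> (nat \<Rightarrow> 'a, 'n, 'y) module_scheme \<Rightarrow>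
    (nat \<Rightarrow> 'a, 'm, 'z) module_scheme \<Rightarrow> ('f, 'n \<Rightarrow> 'm) module" where
  "Hom A D N M =
     function_module {\<phi>. left_module_hom (diff_ops A D) N M \<phi>} (carrier N) (as_F_module A D M)"

end

theory Submission
  imports Defs
begin

text \<open>
  A derivation \<open>\<delta>\<close> gives the \<open>A\<close>-linear map \<open>a[b] \<mapsto> a \<delta>(b)\<close> on the free module, which kills the
  defining relations of \<open>\<Omega>(A)\<close> and so descends to \<open>\<Omega>(A)\<close>. An additive, \<open>A\<close>-linear map that commutes
  with \<open>\<partial>\<close> is \<open>A[\<partial>]\<close>-linear, and for the descended map commutation with \<open>\<partial>\<close> need only be checked on
  \<open>a db\<close>, where it follows from the Leibniz rule and \<open>\<delta>\<partial> = \<partial>\<delta>\<close>. Since the elements \<open>a db\<close> span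
  \<open>\<Omega>(A)\<close>, the map is unique; the inverse bijection is \<open>\<phi> \<mapsto> \<phi> \<circ> d\<close>.

  Associativity of the action of \<open>A[\<partial>]\<close> on any \<open>A\<close>-module with a compatible \<open>\<partial>\<close> reduces to
  \<open>(\<partial> \<circ> q) \<cdot> x = \<partial> (q \<cdot> x)\<close>. That \<open>A[\<partial>]\<close> is a ring is part of the hypothesis that \<open>M\<close> is a left
  module over it.
\<close>

section \<open>Left modules\<close>

lemma abelian_group_hom_additiveI:
  assumes "abelian_group G" "abelian_group H"
    and "\<And>x. x \<in> carrier G \<Longrightarrow> f x \<in> carrier H"
    and "\<And>x y. \<lbrakk>x \<in> carrier G; y \<in> carrier G\<rbrakk> \<Longrightarrow> f (x \<oplus>\<^bsub>G\<^esub> y) = f x \<oplus>\<^bsub>H\<^esub> f y"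
  shows "abelian_group_hom G H f"
  using assms
  by (intro abelian_group_homI group_hom.intro group_hom_axioms.intro homI)
     (auto simp: abelian_group.a_group)

lemma (in abelian_group_hom) hom_finsum:
  assumes "finite S" "f \<in> S \<rightarrow> carrier G"
  shows "h (\<Oplus>\<^bsub>G\<^esub>i\<in>S. f i) = (\<Oplus>\<^bsub>H\<^esub>i\<in>S. h (f i))"
  using assms by (induction S rule: finite_induct) (auto simp: Pi_def)

text \<open>Both cutoffs lie past the support of \<open>f\<close>. This replaces a sum up to
  \<open>deg A p\<close> by a sum up to a convenient bound, since the exact degree of a sum or of a
  monomial depends on which coefficients vanish.\<close>

lemma (in abelian_monoid) finsum_atMost_eq:
  assumes "\<And>i. f i \<in> carrier G" "\<And>i. i > m \<Longrightarrow> f i = \<zero>" "\<And>i. i > n \<Longrightarrow> f i = \<zero>"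
  shows "(\<Oplus>i\<in>{..m::nat}. f i) = (\<Oplus>i\<in>{..n}. f i)"
  by (rule add.finprod_mono_neutral_cong) (use assms in auto)

context left_module
begin

lemma smult_hom: "a \<in> carrier R \<Longrightarrow> abelian_group_hom M M (\<lambda>x. a \<odot>\<^bsub>M\<^esub> x)"
  by (rule abelian_group_hom_additiveI) (auto simp: smult_r_distr M.abelian_group_axioms)

lemma smult_l_hom: "x \<in> carrier M \<Longrightarrow> abelian_group_hom R M (\<lambda>a. a \<odot>\<^bsub>M\<^esub> x)"
  by (rule abelian_group_hom_additiveI)
     (auto simp: smult_l_distr M.abelian_group_axioms R.abelian_group_axioms)

lemma smult_r_null [simp]: "a \<in> carrier R \<Longrightarrow> a \<odot>\<^bsub>M\<^esub> \<zero>\<^bsub>M\<^esub> = \<zero>\<^bsub>M\<^esub>"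
  using abelian_group_hom.hom_zero[OF smult_hom] .

lemma smult_l_null [simp]: "x \<in> carrier M \<Longrightarrow> \<zero>\<^bsub>R\<^esub> \<odot>\<^bsub>M\<^esub> x = \<zero>\<^bsub>M\<^esub>"
  using abelian_group_hom.hom_zero[OF smult_l_hom] .

lemma smult_l_minus:
  "\<lbrakk>a \<in> carrier R; x \<in> carrier M\<rbrakk> \<Longrightarrow> (\<ominus>\<^bsub>R\<^esub> a) \<odot>\<^bsub>M\<^esub> x = \<ominus>\<^bsub>M\<^esub> (a \<odot>\<^bsub>M\<^esub> x)"
  using abelian_group_hom.hom_a_inv[OF smult_l_hom] .

lemma smult_finsum:
  "\<lbrakk>finite S; a \<in> carrier R; f \<in> S \<rightarrow> carrier M\<rbrakk> \<Longrightarrow>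
    a \<odot>\<^bsub>M\<^esub> (\<Oplus>\<^bsub>M\<^esub>i\<in>S. f i) = (\<Oplus>\<^bsub>M\<^esub>i\<in>S. a \<odot>\<^bsub>M\<^esub> f i)"
  by (rule abelian_group_hom.hom_finsum[OF smult_hom])

lemma finsum_smult:
  "\<lbrakk>finite S; f \<in> S \<rightarrow> carrier R; x \<in> carrier M\<rbrakk> \<Longrightarrow>
    (\<Oplus>\<^bsub>R\<^esub>i\<in>S. f i) \<odot>\<^bsub>M\<^esub> x = (\<Oplus>\<^bsub>M\<^esub>i\<in>S. f i \<odot>\<^bsub>M\<^esub> x)"
  by (rule abelian_group_hom.hom_finsum[OF smult_l_hom])

text \<open>The axioms pull back along a ring homomorphism. This turns a left
  \<open>A[\<partial>]\<close>-module into a module over \<open>A\<close> and over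
  \<open>F\<close>.\<close>

lemma restrict_scalars_left_module:
  assumes "ring S" "h \<in> ring_hom S R"
  shows "left_module S (restrict_scalars h M)"
proof -
  interpret S: ring S by fact
  have ab: "abelian_group (restrict_scalars h M)"
    by (rule abelian_groupI)
       (auto simp: restrict_scalars_def M.a_ac intro: M.l_neg)
  show ?thesis
    by (intro left_module.intro left_module_axioms.intro ab assms(1))
       (use ring_hom_memE[OF assms(2)] in
         \<open>auto simp: restrict_scalars_def smult_l_distr smult_r_distr smult_assoc\<close>)
qed

end

lemma restrict_scalars_simps [simp]:
  "carrier (restrict_scalars h M) = carrier M"
  "zero (restrict_scalars h M) = zero M"
  "add (restrict_scalars h M) = add M"
  "smult (restrict_scalars h M) c x = h c \<odot>\<^bsub>M\<^esub> x"
  by (simp_all add: restrict_scalars_def)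

section \<open>Spaces of functions with pointwise operations\<close>

lemma function_module_simps [simp]:
  "carrier (function_module S X V) = S \<inter> extensional X"
  "zero (function_module S X V) = (\<lambda>x\<in>X. \<zero>\<^bsub>V\<^esub>)"
  "add (function_module S X V) f g = (\<lambda>x\<in>X. f x \<oplus>\<^bsub>V\<^esub> g x)"
  "smult (function_module S X V) c f = (\<lambda>x\<in>X. c \<odot>\<^bsub>V\<^esub> f x)"
  by (auto simp: function_module_def)

text \<open>Negation is multiplication by \<open>\<ominus> \<one>\<close>, so closure under scalars
  yields additive inverses; the remaining axioms hold pointwise. \<open>Der\<close> and
  \<open>Hom\<close> are both handled by this criterion.\<close>

lemma (in left_module) function_module_left_module:
  assumes maps: "S \<subseteq> X \<rightarrow> carrier M"
    and zero: "(\<lambda>x\<in>X. \<zero>\<^bsub>M\<^esub>) \<in> S"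
    and add: "\<And>f g. \<lbrakk>f \<in> S; g \<in> S\<rbrakk> \<Longrightarrow> (\<lambda>x\<in>X. f x \<oplus>\<^bsub>M\<^esub> g x) \<in> S"
    and smult: "\<And>c f. \<lbrakk>c \<in> carrier R; f \<in> S\<rbrakk> \<Longrightarrow> (\<lambda>x\<in>X. c \<odot>\<^bsub>M\<^esub> f x) \<in> S"
  shows "left_module R (function_module S X M)"
proof -
  have mem: "f x \<in> carrier M" if "f \<in> S" "x \<in> X" for f x
    using maps that by blast
  have neg: "\<exists>g\<in>S \<inter> extensional X. (\<lambda>x\<in>X. g x \<oplus>\<^bsub>M\<^esub> f x) = (\<lambda>x\<in>X. \<zero>\<^bsub>M\<^esub>)"
    if f: "f \<in> S" for f
  proof
    show "(\<lambda>x\<in>X. (\<ominus>\<^bsub>R\<^esub> \<one>\<^bsub>R\<^esub>) \<odot>\<^bsub>M\<^esub> f x) \<in> S \<inter> extensional X"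
      using smult[OF _ f, of "\<ominus>\<^bsub>R\<^esub> \<one>\<^bsub>R\<^esub>"] by simp
    show "(\<lambda>x\<in>X. (\<lambda>x\<in>X. (\<ominus>\<^bsub>R\<^esub> \<one>\<^bsub>R\<^esub>) \<odot>\<^bsub>M\<^esub> f x) x \<oplus>\<^bsub>M\<^esub> f x) = (\<lambda>x\<in>X. \<zero>\<^bsub>M\<^esub>)"
      using mem[OF f] by (intro restrict_ext) (simp add: smult_l_minus M.l_neg)
  qed
  have ab: "abelian_group (function_module S X M)"
    by (rule abelian_groupI)
       (use neg in \<open>auto simp: mem zero add M.a_ac extensional_def fun_eq_iff\<close>)
  show ?thesis
    by (intro left_module.intro left_module_axioms.intro ab R.ring_axioms)
       (auto simp: mem smult smult_l_distr smult_r_distr smult_assoc extensional_def fun_eq_iff)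
qed

lemma left_module_homI:
  assumes "left_module R M" "left_module R N"
    and "\<And>x. x \<in> carrier M \<Longrightarrow> f x \<in> carrier N"
    and "\<And>x y. \<lbrakk>x \<in> carrier M; y \<in> carrier M\<rbrakk> \<Longrightarrow> f (x \<oplus>\<^bsub>M\<^esub> y) = f x \<oplus>\<^bsub>N\<^esub> f y"
    and "\<And>a x. \<lbrakk>a \<in> carrier R; x \<in> carrier M\<rbrakk> \<Longrightarrow> f (a \<odot>\<^bsub>M\<^esub> x) = a \<odot>\<^bsub>N\<^esub> f x"
  shows "left_module_hom R M N f"
  using assms by (intro left_module_hom.intro left_module_hom_axioms.intro) auto

section \<open>Differential operators\<close>

text \<open>Isolates the ring-theoretic data from which \<open>A[\<partial>]\<close> and the free
  module with its operator are built; the base field enters in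
  \<open>algebra_derivation\<close>.\<close>

locale differential_cring = A: cring A
  for A :: "('f, 'a, 'y) module_scheme" (structure) +
  fixes D
  assumes D_closed [simp]: "a \<in> carrier A \<Longrightarrow> D a \<in> carrier A"
    and D_add: "\<lbrakk>a \<in> carrier A; b \<in> carrier A\<rbrakk> \<Longrightarrow> D (a \<oplus> b) = D a \<oplus> D b"
    and D_mult: "\<lbrakk>a \<in> carrier A; b \<in> carrier A\<rbrakk> \<Longrightarrow> D (a \<otimes> b) = a \<otimes> D b \<oplus> b \<otimes> D a"
begin

lemma D_hom: "abelian_group_hom A A D"
  by (rule abelian_group_hom_additiveI) (auto simp: D_add A.abelian_group_axioms)

lemma D_zero [simp]: "D \<zero> = \<zero>"
  using abelian_group_hom.hom_zero[OF D_hom] .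

lemma D_one [simp]: "D \<one> = \<zero>"
proof -
  have "D \<one> = D \<one> \<oplus> D \<one>"
    using D_mult[of \<one> \<one>] by simp
  then show ?thesis
    by (metis A.add.r_cancel_one' A.one_closed D_closed)
qed

abbreviation Ops where "Ops \<equiv> diff_ops A D"

abbreviation pc where "pc \<equiv> partial_comp A D"

section \<open>Composition in \<open>A[\<partial>]\<close>\<close>

lemma UP: "UP_ring A"
  by (simp add: UP_ring_def A.ring_axioms)

lemma abelian_group_UP: "abelian_group (UP A)"
  using UP_ring.UP_ring[OF UP] ring.is_abelian_group by blast

lemma UP_simps [simp]:
  "carrier (UP A) = up A"
  "zero (UP A) = (\<lambda>i. \<zero>)"
  "\<lbrakk>p \<in> up A; q \<in> up A\<rbrakk> \<Longrightarrow> add (UP A) p q = (\<lambda>i. p i \<oplus> q i)"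
  "\<lbrakk>a \<in> carrier A; p \<in> up A\<rbrakk> \<Longrightarrow> smult (UP A) a p = (\<lambda>i. a \<otimes> p i)"
  by (simp_all add: UP_def)

lemma Ops_simps [simp]:
  "carrier Ops = up A"
  "zero Ops = (\<lambda>i. \<zero>)"
  "one Ops = (\<lambda>i. if i = 0 then \<one> else \<zero>)"
  "\<lbrakk>p \<in> up A; q \<in> up A\<rbrakk> \<Longrightarrow> add Ops p q = (\<lambda>i. p i \<oplus> q i)"
  "a \<in> carrier A \<Longrightarrow> monom Ops a n = (\<lambda>i. if i = n then a else \<zero>)"
  by (simp_all add: UP_def diff_ops_def)

lemma finsum_Ops: "finsum Ops = finsum (UP A)"
  by (simp add: finsum_def diff_ops_def)

lemma monom_closed [simp]: "a \<in> carrier A \<Longrightarrow> (\<lambda>i. if i = n then a else \<zero>) \<in> up A"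
  by (auto simp: up_def)

lemma zero_up_closed [simp]: "(\<lambda>i. \<zero>) \<in> up A"
  by (auto simp: up_def)

lemma smult_up_closed [simp]: "\<lbrakk>a \<in> carrier A; p \<in> up A\<rbrakk> \<Longrightarrow> (\<lambda>i. a \<otimes> p i) \<in> up A"
  by (rule A.up_smult_closed)

lemma add_up_closed [simp]: "\<lbrakk>p \<in> up A; q \<in> up A\<rbrakk> \<Longrightarrow> (\<lambda>i. p i \<oplus> q i) \<in> up A"
  by (rule A.up_add_closed)

lemma above_deg: "\<lbrakk>p \<in> up A; deg A p < i\<rbrakk> \<Longrightarrow> p i = \<zero>"
  using UP_ring.deg_aboveD[OF UP, of p i] by (simp add: UP_def)

lemma left_module_UP: "left_module A (UP A)"
  by (intro left_module.intro left_module_axioms.intro A.ring_axioms abelian_group_UP)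
     (auto simp: A.l_distr A.r_distr A.m_assoc mem_upD)

lemma pc_closed [simp]:
  assumes "p \<in> up A"
  shows "pc p \<in> up A"
proof (rule mem_upI)
  show "pc p n \<in> carrier A" for n
    using assms by (auto simp: partial_comp_def mem_upD)
  show "\<exists>n. bound \<zero> n (pc p)"
  proof
    \<comment> \<open>Composition with \<partial> shifts coefficients by one place, so the degree
      grows by at most one.\<close>
    show "bound \<zero> (Suc (deg A p)) (pc p)"
      using assms by (auto simp: partial_comp_def above_deg)
  qed
qed

lemma pc_pow_closed [simp]: "p \<in> up A \<Longrightarrow> (pc ^^ i) p \<in> up A"
  by (induction i) auto

text \<open>Terms past the degree of \<open>p\<close> vanish, so any bound on the support of
  \<open>p\<close> may replace \<open>deg A p\<close>. For a monomial the exponent serves as the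
  bound, even when the coefficient is zero.\<close>

lemma Ops_mult:
  assumes "p \<in> up A" "q \<in> up A" "\<And>i. i > n \<Longrightarrow> p i = \<zero>"
  shows "p \<otimes>\<^bsub>Ops\<^esub> q = (\<Oplus>\<^bsub>UP A\<^esub>i\<in>{..n}. p i \<odot>\<^bsub>UP A\<^esub> (pc ^^ i) q)"
proof -
  interpret U: left_module A "UP A" by (rule left_module_UP)
  have "p \<otimes>\<^bsub>Ops\<^esub> q = (\<Oplus>\<^bsub>UP A\<^esub>i\<in>{..deg A p}. p i \<odot>\<^bsub>UP A\<^esub> (pc ^^ i) q)"
    by (simp add: diff_ops_def)
  also have "\<dots> = (\<Oplus>\<^bsub>UP A\<^esub>i\<in>{..n}. p i \<odot>\<^bsub>UP A\<^esub> (pc ^^ i) q)"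
    by (rule U.finsum_atMost_eq) (use assms U.smult_l_null in \<open>simp_all add: mem_upD above_deg\<close>)
  finally show ?thesis .
qed

lemma const_mult:
  assumes "a \<in> carrier A" "q \<in> up A"
  shows "monom Ops a 0 \<otimes>\<^bsub>Ops\<^esub> q = (\<lambda>i. a \<otimes> q i)"
proof -
  interpret U: left_module A "UP A" by (rule left_module_UP)
  show ?thesis
    using assms by (subst Ops_mult[where n = 0]) (auto simp: U.M.finsum_0 mem_upD)
qed

lemma partial_mult:
  assumes q: "q \<in> up A"
  shows "monom Ops \<one> 1 \<otimes>\<^bsub>Ops\<^esub> q = pc q"
proof -
  interpret U: left_module A "UP A" by (rule left_module_UP)
  have "monom Ops \<one> 1 \<otimes>\<^bsub>Ops\<^esub> q =
      (\<Oplus>\<^bsub>UP A\<^esub>i\<in>{..Suc 0}. monom Ops \<one> 1 i \<odot>\<^bsub>UP A\<^esub> (pc ^^ i) q)"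
    using q by (intro Ops_mult) auto
  also have "\<dots> = \<one> \<odot>\<^bsub>UP A\<^esub> pc q \<oplus>\<^bsub>UP A\<^esub> (\<Oplus>\<^bsub>UP A\<^esub>i\<in>{..0::nat}. \<zero>\<^bsub>UP A\<^esub>)"
    using q by (subst U.M.finsum_Suc) (auto simp: mem_upD)
  also have "\<dots> = pc q"
    using q U.smult_one[of "pc q"] U.M.r_zero[of "pc q"] by (simp only: U.M.finsum_zero) simp
  finally show ?thesis .
qed

text \<open>\<open>D \<one>\<close> is zero, so only the shift of coefficients contributes.\<close>

lemma pc_monom:
  "pc (\<lambda>i. if i = n then \<one> else \<zero>) = (\<lambda>i. if i = Suc n then \<one> else \<zero>)"
  by (auto simp: partial_comp_def fun_eq_iff)

lemma pc_pow_const: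
  assumes "a \<in> carrier A" "D a = \<zero>"
  shows "(pc ^^ n) (monom Ops a 0) = monom Ops a n"
  using assms by (induction n) (auto simp: partial_comp_def fun_eq_iff)

lemma up_repr:
  assumes "p \<in> up A"
  shows "p = (\<Oplus>\<^bsub>UP A\<^esub>i\<in>{..deg A p}. monom Ops (p i) i)"
proof -
  have "monom (UP A) a i = monom Ops a i" for a i
    by (simp add: diff_ops_def)
  moreover have "coeff (UP A) p = p"
    using assms by (simp add: UP_def)
  ultimately show ?thesis
    using UP_ring.up_repr[OF UP, of p] assms by simp
qed

text \<open>An element killed by \<open>D\<close> passes through every power of \<partial>, by
  \<open>pc_pow_const\<close>, and commutes with the coefficients because \<open>A\<close> is
  commutative: both products are \<open>\<Sum> a p_i \<partial>^i\<close>. This is what makes the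
  scalars of \<open>F\<close> act by \<open>A[\<partial>]\<close>-linear maps.\<close>

lemma const_commutes:
  assumes "a \<in> carrier A" "D a = \<zero>" "p \<in> up A"
  shows "p \<otimes>\<^bsub>Ops\<^esub> monom Ops a 0 = monom Ops a 0 \<otimes>\<^bsub>Ops\<^esub> p"
proof -
  interpret U: left_module A "UP A" by (rule left_module_UP)
  have ma: "monom Ops a i \<in> up A" for i
    using assms by simp
  have "p \<otimes>\<^bsub>Ops\<^esub> monom Ops a 0 =
      (\<Oplus>\<^bsub>UP A\<^esub>i\<in>{..deg A p}. p i \<odot>\<^bsub>UP A\<^esub> (pc ^^ i) (monom Ops a 0))"
    using assms ma above_deg by (intro Ops_mult) auto
  also have "\<dots> = (\<Oplus>\<^bsub>UP A\<^esub>i\<in>{..deg A p}. p i \<odot>\<^bsub>UP A\<^esub> monom Ops a i)"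
    using assms by (simp only: pc_pow_const)
  also have "\<dots> = (\<Oplus>\<^bsub>UP A\<^esub>i\<in>{..deg A p}. a \<odot>\<^bsub>UP A\<^esub> monom Ops (p i) i)"
    using assms by (intro U.M.finsum_cong') (auto simp: mem_upD fun_eq_iff A.m_comm)
  also have "\<dots> = a \<odot>\<^bsub>UP A\<^esub> p"
    using assms by (subst (3) up_repr) (simp_all add: U.smult_finsum mem_upD)
  finally show ?thesis
    using assms by (simp only: const_mult) simp
qed

lemma const_ring_hom: "(\<lambda>a. monom Ops a 0) \<in> ring_hom A Ops"
proof (rule ring_hom_memI)
  fix a b assume ab: "a \<in> carrier A" "b \<in> carrier A"
  show "monom Ops (a \<otimes> b) 0 = monom Ops a 0 \<otimes>\<^bsub>Ops\<^esub> monom Ops b 0"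
    using ab by (subst const_mult) auto
qed auto

end

section \<open>The action of \<open>A[\<partial>]\<close> on an \<open>A\<close>-module with a
  compatible \<partial>\<close>

definition ops_module ::
  "('f, 'a, 'x) module_scheme \<Rightarrow> ('a, 'k, 'y) module_scheme \<Rightarrow> ('k \<Rightarrow> 'k) \<Rightarrow> (nat \<Rightarrow> 'a, 'k) module"
  where "ops_module A K Q = \<lparr>carrier = carrier K, mult = undefined, one = undefined,
     zero = zero K, add = add K,
     smult = (\<lambda>p x. \<Oplus>\<^bsub>K\<^esub>i\<in>{..deg A p}. p i \<odot>\<^bsub>K\<^esub> (Q ^^ i) x)\<rparr>"

text \<open>The Leibniz rule for \<open>Q\<close> over \<open>D\<close> is what makes the formula of
  \<open>ops_module\<close> an action. \<open>Omega\<close> is the instance with \<open>K\<close>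
  the module of differentials and \<open>Q\<close> its induced \<partial>.\<close>

locale differential_module = differential_cring A D + K: left_module A K
  for A :: "('f, 'a, 'y) module_scheme" (structure) and D
    and K :: "('a, 'k, 'z) module_scheme" +
  fixes Q
  assumes Q_closed [simp]: "x \<in> carrier K \<Longrightarrow> Q x \<in> carrier K"
    and Q_add: "\<lbrakk>x \<in> carrier K; y \<in> carrier K\<rbrakk> \<Longrightarrow> Q (x \<oplus>\<^bsub>K\<^esub> y) = Q x \<oplus>\<^bsub>K\<^esub> Q y"
    and Q_smult: "\<lbrakk>a \<in> carrier A; x \<in> carrier K\<rbrakk> \<Longrightarrow>
      Q (a \<odot>\<^bsub>K\<^esub> x) = D a \<odot>\<^bsub>K\<^esub> x \<oplus>\<^bsub>K\<^esub> a \<odot>\<^bsub>K\<^esub> Q x"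
begin

abbreviation Act where "Act \<equiv> ops_module A K Q"

lemma Act_simps [simp]:
  "carrier Act = carrier K" "zero Act = zero K" "add Act = add K"
  by (simp_all add: ops_module_def)

lemma abelian_group_Act: "abelian_group Act"
  by (rule abelian_groupI) (auto simp: K.M.a_ac intro: K.M.l_neg)

lemma Q_hom: "abelian_group_hom K K Q"
  by (rule abelian_group_hom_additiveI) (auto simp: Q_add K.M.abelian_group_axioms)

lemma Q_pow_closed [simp]: "x \<in> carrier K \<Longrightarrow> (Q ^^ i) x \<in> carrier K"
  by (induction i) auto

lemma Q_pow_add:
  "\<lbrakk>x \<in> carrier K; y \<in> carrier K\<rbrakk> \<Longrightarrow> (Q ^^ i) (x \<oplus>\<^bsub>K\<^esub> y) = (Q ^^ i) x \<oplus>\<^bsub>K\<^esub> (Q ^^ i) y"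
  by (induction i) (auto simp: Q_add)

lemma term_closed [simp]:
  "\<lbrakk>p \<in> up A; x \<in> carrier K\<rbrakk> \<Longrightarrow> p i \<odot>\<^bsub>K\<^esub> (Q ^^ j) x \<in> carrier K"
  by (simp add: mem_upD)

lemma act_eq:
  assumes "p \<in> up A" "x \<in> carrier K" "\<And>i. i > n \<Longrightarrow> p i = \<zero>"
  shows "p \<odot>\<^bsub>Act\<^esub> x = (\<Oplus>\<^bsub>K\<^esub>i\<in>{..n}. p i \<odot>\<^bsub>K\<^esub> (Q ^^ i) x)"
  unfolding ops_module_def using assms
  by simp (rule K.M.finsum_atMost_eq, simp_all add: above_deg)

lemma act_closed [simp]: "\<lbrakk>p \<in> up A; x \<in> carrier K\<rbrakk> \<Longrightarrow> p \<odot>\<^bsub>Act\<^esub> x \<in> carrier K"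
  unfolding ops_module_def by (auto intro!: K.M.finsum_closed)

lemma act_add_l:
  assumes "p \<in> up A" "q \<in> up A" "x \<in> carrier K"
  shows "(\<lambda>i. p i \<oplus> q i) \<odot>\<^bsub>Act\<^esub> x = p \<odot>\<^bsub>Act\<^esub> x \<oplus>\<^bsub>K\<^esub> q \<odot>\<^bsub>Act\<^esub> x"
proof -
  \<comment> \<open>A common bound is used because cancellation may lower the degree of the
    sum.\<close>
  let ?n = "max (deg A p) (deg A q)"
  have "(\<lambda>i. p i \<oplus> q i) \<odot>\<^bsub>Act\<^esub> x = (\<Oplus>\<^bsub>K\<^esub>i\<in>{..?n}. (p i \<oplus> q i) \<odot>\<^bsub>K\<^esub> (Q ^^ i) x)"
    using assms by (intro act_eq) (auto simp: above_deg)
  also have "\<dots> = (\<Oplus>\<^bsub>K\<^esub>i\<in>{..?n}. p i \<odot>\<^bsub>K\<^esub> (Q ^^ i) x \<oplus>\<^bsub>K\<^esub> q i \<odot>\<^bsub>K\<^esub> (Q ^^ i) x)"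
    using assms by (intro K.M.finsum_cong') (auto simp: K.smult_l_distr mem_upD)
  also have "\<dots> = (\<Oplus>\<^bsub>K\<^esub>i\<in>{..?n}. p i \<odot>\<^bsub>K\<^esub> (Q ^^ i) x) \<oplus>\<^bsub>K\<^esub> (\<Oplus>\<^bsub>K\<^esub>i\<in>{..?n}. q i \<odot>\<^bsub>K\<^esub> (Q ^^ i) x)"
    using assms by (intro K.M.finsum_addf) auto
  also have "\<dots> = p \<odot>\<^bsub>Act\<^esub> x \<oplus>\<^bsub>K\<^esub> q \<odot>\<^bsub>Act\<^esub> x"
    using assms by (simp add: act_eq[of _ x ?n] above_deg)
  finally show ?thesis .
qed

lemma act_add_r:
  assumes "p \<in> up A" "x \<in> carrier K" "y \<in> carrier K"
  shows "p \<odot>\<^bsub>Act\<^esub> (x \<oplus>\<^bsub>K\<^esub> y) = p \<odot>\<^bsub>Act\<^esub> x \<oplus>\<^bsub>K\<^esub> p \<odot>\<^bsub>Act\<^esub> y"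
  unfolding ops_module_def using assms
  by (simp add: Q_pow_add K.smult_r_distr mem_upD K.M.finsum_addf Pi_def)

lemma act_const:
  "\<lbrakk>a \<in> carrier A; x \<in> carrier K\<rbrakk> \<Longrightarrow> monom Ops a 0 \<odot>\<^bsub>Act\<^esub> x = a \<odot>\<^bsub>K\<^esub> x"
  by (subst act_eq[where n = 0]) (auto simp: K.M.finsum_0)

lemma act_partial:
  assumes "x \<in> carrier K"
  shows "monom Ops \<one> 1 \<odot>\<^bsub>Act\<^esub> x = Q x"
proof -
  have "monom Ops \<one> 1 \<odot>\<^bsub>Act\<^esub> x = (\<Oplus>\<^bsub>K\<^esub>i\<in>{..Suc 0}. monom Ops \<one> 1 i \<odot>\<^bsub>K\<^esub> (Q ^^ i) x)"
    using assms by (intro act_eq) auto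
  also have "\<dots> = Q x"
    using assms by (subst K.M.finsum_Suc) auto
  finally show ?thesis .
qed

lemma act_hom: "x \<in> carrier K \<Longrightarrow> abelian_group_hom (UP A) K (\<lambda>p. p \<odot>\<^bsub>Act\<^esub> x)"
  by (rule abelian_group_hom_additiveI) (auto simp: act_add_l abelian_group_UP K.M.abelian_group_axioms)

lemma act_smult:
  assumes "a \<in> carrier A" "p \<in> up A" "x \<in> carrier K"
  shows "(\<lambda>i. a \<otimes> p i) \<odot>\<^bsub>Act\<^esub> x = a \<odot>\<^bsub>K\<^esub> (p \<odot>\<^bsub>Act\<^esub> x)"
proof -
  have "(\<lambda>i. a \<otimes> p i) \<odot>\<^bsub>Act\<^esub> x = (\<Oplus>\<^bsub>K\<^esub>i\<in>{..deg A p}. (a \<otimes> p i) \<odot>\<^bsub>K\<^esub> (Q ^^ i) x)"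
    using assms by (intro act_eq) (auto simp: above_deg)
  also have "\<dots> = (\<Oplus>\<^bsub>K\<^esub>i\<in>{..deg A p}. a \<odot>\<^bsub>K\<^esub> (p i \<odot>\<^bsub>K\<^esub> (Q ^^ i) x))"
    using assms by (intro K.M.finsum_cong') (auto simp: K.smult_assoc mem_upD)
  also have "\<dots> = a \<odot>\<^bsub>K\<^esub> (p \<odot>\<^bsub>Act\<^esub> x)"
    using assms by (simp add: ops_module_def K.smult_finsum)
  finally show ?thesis .
qed

text \<open>By the Leibniz rule, \<open>Q (p_i Q^i x) = (D p_i) Q^i x + p_i Q^(i+1) x\<close>; the
  coefficients of \<open>pc p\<close> collect these two kinds of terms, the second after an index
  shift by one.\<close>

lemma act_pc:
  assumes p: "p \<in> up A" and x: "x \<in> carrier K"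
  shows "pc p \<odot>\<^bsub>Act\<^esub> x = Q (p \<odot>\<^bsub>Act\<^esub> x)"
proof -
  \<comment> \<open>\<open>?s\<close> is the coefficient sequence of \<open>p\<close> moved up by
    one place.\<close>
  let ?n = "deg A p" and ?s = "\<lambda>i. if i = 0 then \<zero> else p (i - 1)"
  have [simp]: "p i \<in> carrier A" for i
    using p by (rule mem_upD)
  have s [simp]: "?s i \<in> carrier A" for i
    by simp
  have "pc p \<odot>\<^bsub>Act\<^esub> x = (\<Oplus>\<^bsub>K\<^esub>i\<in>{..Suc ?n}. (D (p i) \<oplus> ?s i) \<odot>\<^bsub>K\<^esub> (Q ^^ i) x)"
    using p x by (subst act_eq[OF pc_closed, where n = "Suc ?n"]) (auto simp: above_deg partial_comp_def)
  also have "\<dots> = (\<Oplus>\<^bsub>K\<^esub>i\<in>{..Suc ?n}. D (p i) \<odot>\<^bsub>K\<^esub> (Q ^^ i) x \<oplus>\<^bsub>K\<^esub> ?s i \<odot>\<^bsub>K\<^esub> (Q ^^ i) x)"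
    using x s by (intro K.M.finsum_cong') (auto simp: K.smult_l_distr)
  also have "\<dots> = (\<Oplus>\<^bsub>K\<^esub>i\<in>{..Suc ?n}. D (p i) \<odot>\<^bsub>K\<^esub> (Q ^^ i) x) \<oplus>\<^bsub>K\<^esub>
      (\<Oplus>\<^bsub>K\<^esub>i\<in>{..Suc ?n}. ?s i \<odot>\<^bsub>K\<^esub> (Q ^^ i) x)"
    using x by (intro K.M.finsum_addf) auto
  \<comment> \<open>The top term drops: \<open>p\<close> vanishes at \<open>Suc ?n\<close> and
    \<open>D \<zero> = \<zero>\<close>.\<close>
  also have "(\<Oplus>\<^bsub>K\<^esub>i\<in>{..Suc ?n}. D (p i) \<odot>\<^bsub>K\<^esub> (Q ^^ i) x) = (\<Oplus>\<^bsub>K\<^esub>i\<in>{..?n}. D (p i) \<odot>\<^bsub>K\<^esub> (Q ^^ i) x)"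
    using p x by (intro K.M.finsum_atMost_eq) (auto simp: above_deg)
  \<comment> \<open>The shifted sequence is zero at index 0, so splitting off that term and
    reindexing leaves a sum up to \<open>?n\<close>.\<close>
  also have "(\<Oplus>\<^bsub>K\<^esub>i\<in>{..Suc ?n}. ?s i \<odot>\<^bsub>K\<^esub> (Q ^^ i) x) = (\<Oplus>\<^bsub>K\<^esub>i\<in>{..?n}. p i \<odot>\<^bsub>K\<^esub> Q ((Q ^^ i) x))"
    using x by (subst K.M.finsum_Suc2) (auto intro!: K.M.r_zero K.M.finsum_closed)
  also have "(\<Oplus>\<^bsub>K\<^esub>i\<in>{..?n}. D (p i) \<odot>\<^bsub>K\<^esub> (Q ^^ i) x) \<oplus>\<^bsub>K\<^esub> \<dots> =
      (\<Oplus>\<^bsub>K\<^esub>i\<in>{..?n}. D (p i) \<odot>\<^bsub>K\<^esub> (Q ^^ i) x \<oplus>\<^bsub>K\<^esub> p i \<odot>\<^bsub>K\<^esub> Q ((Q ^^ i) x))"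
    using x by (intro K.M.finsum_addf[symmetric]) auto
  also have "\<dots> = (\<Oplus>\<^bsub>K\<^esub>i\<in>{..?n}. Q (p i \<odot>\<^bsub>K\<^esub> (Q ^^ i) x))"
    using x by (intro K.M.finsum_cong') (auto simp: Q_smult)
  also have "\<dots> = Q (p \<odot>\<^bsub>Act\<^esub> x)"
    using x by (simp add: ops_module_def abelian_group_hom.hom_finsum[OF Q_hom])
  finally show ?thesis .
qed

lemma act_pc_pow:
  "\<lbrakk>p \<in> up A; x \<in> carrier K\<rbrakk> \<Longrightarrow> (pc ^^ i) p \<odot>\<^bsub>Act\<^esub> x = (Q ^^ i) (p \<odot>\<^bsub>Act\<^esub> x)"
  by (induction i) (auto simp: act_pc)

text \<open>The product is the sum of the \<open>p_i (pc ^^ i) q\<close>. Additivity in the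
  operator, \<open>act_smult\<close> and \<open>act_pc_pow\<close> turn the action of each summand
  on \<open>x\<close> into \<open>p_i Q^i\<close> applied to the action of \<open>q\<close> on
  \<open>x\<close>.\<close>

lemma act_mult:
  assumes p: "p \<in> up A" and q: "q \<in> up A" and x: "x \<in> carrier K"
  shows "(p \<otimes>\<^bsub>Ops\<^esub> q) \<odot>\<^bsub>Act\<^esub> x = p \<odot>\<^bsub>Act\<^esub> (q \<odot>\<^bsub>Act\<^esub> x)"
proof -
  have [simp]: "p i \<in> carrier A" for i
    using p by (rule mem_upD)
  have "(p \<otimes>\<^bsub>Ops\<^esub> q) \<odot>\<^bsub>Act\<^esub> x =
      (\<Oplus>\<^bsub>UP A\<^esub>i\<in>{..deg A p}. p i \<odot>\<^bsub>UP A\<^esub> (pc ^^ i) q) \<odot>\<^bsub>Act\<^esub> x"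
    using p q by (subst Ops_mult) (auto simp: above_deg)
  also have "\<dots> = (\<Oplus>\<^bsub>K\<^esub>i\<in>{..deg A p}. (p i \<odot>\<^bsub>UP A\<^esub> (pc ^^ i) q) \<odot>\<^bsub>Act\<^esub> x)"
    using q x by (intro abelian_group_hom.hom_finsum[OF act_hom]) auto
  also have "\<dots> = (\<Oplus>\<^bsub>K\<^esub>i\<in>{..deg A p}. p i \<odot>\<^bsub>K\<^esub> (Q ^^ i) (q \<odot>\<^bsub>Act\<^esub> x))"
    using q x by (intro K.M.finsum_cong') (auto simp: act_smult act_pc_pow)
  also have "\<dots> = p \<odot>\<^bsub>Act\<^esub> (q \<odot>\<^bsub>Act\<^esub> x)"
    by (simp add: ops_module_def)
  finally show ?thesis .
qed

lemma left_module_Act: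
  assumes "ring Ops"
  shows "left_module Ops Act"
proof (intro left_module.intro left_module_axioms.intro assms abelian_group_Act)
  show "\<one>\<^bsub>Ops\<^esub> \<odot>\<^bsub>Act\<^esub> x = x" if "x \<in> carrier Act" for x
    using that act_const[of \<one> x] by simp
qed (simp_all add: act_add_l act_add_r act_mult)

end

text \<open>Since \<open>p_i \<partial>^i\<close> is the product of the constant \<open>p_i\<close>
  and the power \<open>\<partial>^i\<close>, the actions of the constants and of \<partial>
  determine any left \<open>A[\<partial>]\<close>-module structure.\<close>

lemma (in differential_cring) smult_expand:
  assumes M: "left_module Ops M" and p: "p \<in> up A" and x: "x \<in> carrier M"
  shows "p \<odot>\<^bsub>M\<^esub> x = (\<Oplus>\<^bsub>M\<^esub>i\<in>{..deg A p}.
    monom Ops (p i) 0 \<odot>\<^bsub>M\<^esub> ((\<lambda>y. monom Ops \<one> 1 \<odot>\<^bsub>M\<^esub> y) ^^ i) x)"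
proof -
  interpret M: left_module Ops M by fact
  let ?Q = "\<lambda>y. monom Ops \<one> 1 \<odot>\<^bsub>M\<^esub> y"
  have [simp]: "p i \<in> carrier A" for i
    using p by (rule mem_upD)
  have mo: "monom Ops a i \<in> carrier Ops" if "a \<in> carrier A" for a i
    using that by simp
  \<comment> \<open>\<open>monom Ops \<one> i\<close> acts as the \<open>i\<close>-th iterate of
    \<partial>, because composing it with \<partial> on the left just raises the exponent.\<close>
  have pow: "monom Ops \<one> i \<odot>\<^bsub>M\<^esub> x = (?Q ^^ i) x" for i
  proof (induction i)
    case 0
    show ?case
      using M.smult_one[OF x] by simp
  next
    case (Suc i)
    have "monom Ops \<one> (Suc i) = monom Ops \<one> 1 \<otimes>\<^bsub>Ops\<^esub> monom Ops \<one> i"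
      by (subst partial_mult) (auto simp: pc_monom)
    then show ?case
      using Suc M.smult_assoc[of "monom Ops \<one> 1" "monom Ops \<one> i" x] x by (simp add: mo)
  qed
  have "p \<odot>\<^bsub>M\<^esub> x = (\<Oplus>\<^bsub>Ops\<^esub>i\<in>{..deg A p}. monom Ops (p i) i) \<odot>\<^bsub>M\<^esub> x"
    using up_repr[OF p] by (simp add: finsum_Ops)
  also have "\<dots> = (\<Oplus>\<^bsub>M\<^esub>i\<in>{..deg A p}. monom Ops (p i) i \<odot>\<^bsub>M\<^esub> x)"
    using x by (intro M.finsum_smult) auto
  also have "\<dots> = (\<Oplus>\<^bsub>M\<^esub>i\<in>{..deg A p}. monom Ops (p i) 0 \<odot>\<^bsub>M\<^esub> (?Q ^^ i) x)"
  proof (rule arg_cong[where f = "\<lambda>f. finsum M f {..deg A p}"], rule ext)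
    fix i
    have "monom Ops (p i) i = monom Ops (p i) 0 \<otimes>\<^bsub>Ops\<^esub> monom Ops \<one> i"
      by (subst const_mult) auto
    then show "monom Ops (p i) i \<odot>\<^bsub>M\<^esub> x = monom Ops (p i) 0 \<odot>\<^bsub>M\<^esub> (?Q ^^ i) x"
      using M.smult_assoc[of "monom Ops (p i) 0" "monom Ops \<one> i" x] x by (simp only: mo pow) simp
  qed
  finally show ?thesis .
qed

text \<open>Both actions expand over powers of \<partial>: by definition in \<open>Act\<close>, by
  \<open>smult_expand\<close> in \<open>M\<close>. Compatibility with constants and with \<partial>
  then matches the two sums term by term.\<close>

lemma (in differential_module) left_module_hom_ActI:
  assumes M: "left_module Ops M"
    and closed: "\<And>x. x \<in> carrier K \<Longrightarrow> f x \<in> carrier M"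
    and add: "\<And>x y. \<lbrakk>x \<in> carrier K; y \<in> carrier K\<rbrakk> \<Longrightarrow> f (x \<oplus>\<^bsub>K\<^esub> y) = f x \<oplus>\<^bsub>M\<^esub> f y"
    and smult: "\<And>a x. \<lbrakk>a \<in> carrier A; x \<in> carrier K\<rbrakk> \<Longrightarrow> f (a \<odot>\<^bsub>K\<^esub> x) = monom Ops a 0 \<odot>\<^bsub>M\<^esub> f x"
    and partial: "\<And>x. x \<in> carrier K \<Longrightarrow> f (Q x) = monom Ops \<one> 1 \<odot>\<^bsub>M\<^esub> f x"
  shows "left_module_hom Ops Act M f"
proof -
  interpret M: left_module Ops M by fact
  interpret f: abelian_group_hom K M f
    by (rule abelian_group_hom_additiveI) (use closed add in \<open>auto simp: K.M.abelian_group_axioms M.M.abelian_group_axioms\<close>)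
  let ?Q = "\<lambda>y. monom Ops \<one> 1 \<odot>\<^bsub>M\<^esub> y"
  have pow: "f ((Q ^^ i) x) = (?Q ^^ i) (f x)" if "x \<in> carrier K" for x i
    using that by (induction i) (simp_all only: funpow.simps o_apply id_apply Q_pow_closed partial)
  show ?thesis
  proof (rule left_module_homI[OF left_module_Act[OF M.R.ring_axioms] M])
    fix p x assume p: "p \<in> carrier Ops" and x: "x \<in> carrier Act"
    have [simp]: "p i \<in> carrier A" for i
      using p by (auto intro: mem_upD)
    have "f (p \<odot>\<^bsub>Act\<^esub> x) = (\<Oplus>\<^bsub>M\<^esub>i\<in>{..deg A p}. f (p i \<odot>\<^bsub>K\<^esub> (Q ^^ i) x))"
      using p x by (simp add: ops_module_def f.hom_finsum)
    also have "\<dots> = (\<Oplus>\<^bsub>M\<^esub>i\<in>{..deg A p}. monom Ops (p i) 0 \<odot>\<^bsub>M\<^esub> (?Q ^^ i) (f x))"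
      using x by (simp only: smult pow Q_pow_closed Act_simps \<open>\<And>i. p i \<in> carrier A\<close>)
    also have "\<dots> = p \<odot>\<^bsub>M\<^esub> f x"
      using smult_expand[OF M, of p "f x"] p x closed by simp
    finally show "f (p \<odot>\<^bsub>Act\<^esub> x) = p \<odot>\<^bsub>M\<^esub> f x" .
  qed (use closed add in auto)
qed

section \<open>The free module and its quotient\<close>

text \<open>Extends \<open>a[b] \<mapsto> g a b\<close> to the free module. The function
  \<open>g\<close> is meant to be additive in \<open>a\<close> but possibly not
  \<open>A\<close>-linear, so that one construction covers \<partial> on the free module as well as
  the linear map attached to a derivation.\<close>

definition additive_extension ::
  "('f, 'a, 'x) module_scheme \<Rightarrow> ('m, 'y) ring_scheme \<Rightarrow> ('a \<Rightarrow> 'a \<Rightarrow> 'm) \<Rightarrow> ('a \<Rightarrow> 'a) \<Rightarrow> 'm" where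
  "additive_extension A G g u = (\<Oplus>\<^bsub>G\<^esub>b\<in>{b. u b \<noteq> \<zero>\<^bsub>A\<^esub>}. g (u b) b)"

section \<open>The free module of finitely supported functions\<close>

context differential_cring
begin

abbreviation Free where "Free \<equiv> free_module A"

lemma Free_simps [simp]:
  "zero Free = (\<lambda>b. \<zero>)"
  "add Free u v = (\<lambda>b. u b \<oplus> v b)"
  "smult Free a u = (\<lambda>b. a \<otimes> u b)"
  by (simp_all add: free_module_def)

lemma Free_carrier:
  "u \<in> carrier Free \<longleftrightarrow>
    (\<forall>b. u b \<in> carrier A) \<and> (\<forall>b. b \<notin> carrier A \<longrightarrow> u b = \<zero>) \<and> finite {b. u b \<noteq> \<zero>}"
  by (simp add: free_module_def)

lemma Free_apply [simp]: "u \<in> carrier Free \<Longrightarrow> u b \<in> carrier A"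
  by (simp add: Free_carrier)

lemma Free_support: "u \<in> carrier Free \<Longrightarrow> finite {b. u b \<noteq> \<zero>} \<and> {b. u b \<noteq> \<zero>} \<subseteq> carrier A"
  by (auto simp: Free_carrier)

lemma Free_closed:
  assumes "\<And>b. v b \<in> carrier A" "finite S" "S \<subseteq> carrier A" "\<And>b. b \<notin> S \<Longrightarrow> v b = \<zero>"
  shows "v \<in> carrier Free"
proof -
  have "{b. v b \<noteq> \<zero>} \<subseteq> S"
    using assms(4) by blast
  then show ?thesis
    using assms finite_subset[of _ S] by (auto simp: Free_carrier)
qed

lemma Free_term_closed [simp]:
  "\<lbrakk>a \<in> carrier A; b \<in> carrier A\<rbrakk> \<Longrightarrow> free_term A a b \<in> carrier Free"
  by (rule Free_closed[where S = "{b}"]) (auto simp: free_term_def)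

lemma Free_zero_closed [simp]: "(\<lambda>b. \<zero>) \<in> carrier Free"
  by (simp add: Free_carrier)

lemma Free_add_closed [simp]:
  assumes "u \<in> carrier Free" "v \<in> carrier Free"
  shows "(\<lambda>b. u b \<oplus> v b) \<in> carrier Free"
  by (rule Free_closed[where S = "{b. u b \<noteq> \<zero>} \<union> {b. v b \<noteq> \<zero>}"])
     (use assms Free_support in auto)

lemma Free_smult_closed [simp]:
  assumes "a \<in> carrier A" "u \<in> carrier Free"
  shows "(\<lambda>b. a \<otimes> u b) \<in> carrier Free"
  by (rule Free_closed[where S = "{b. u b \<noteq> \<zero>}"]) (use assms Free_support in auto)

lemma abelian_group_Free: "abelian_group Free"
proof (rule abelian_groupI)
  fix u assume u: "u \<in> carrier Free"
  show "\<exists>v\<in>carrier Free. v \<oplus>\<^bsub>Free\<^esub> u = \<zero>\<^bsub>Free\<^esub>"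
  proof
    show "(\<lambda>b. (\<ominus> \<one>) \<otimes> u b) \<in> carrier Free"
      using u by (intro Free_smult_closed) auto
    show "(\<lambda>b. (\<ominus> \<one>) \<otimes> u b) \<oplus>\<^bsub>Free\<^esub> u = \<zero>\<^bsub>Free\<^esub>"
      using u by (simp add: A.l_minus A.l_neg)
  qed
qed (auto simp: A.a_ac)

lemma left_module_Free: "left_module A Free"
  by (intro left_module.intro left_module_axioms.intro A.ring_axioms abelian_group_Free)
     (auto simp: A.l_distr A.r_distr A.m_assoc)

lemma module_Free: "module A Free"
  by (intro module.intro module_axioms.intro A.cring_axioms abelian_group_Free)
     (auto simp: A.l_distr A.r_distr A.m_assoc)

lemma free_term_smult:
  "\<lbrakk>a \<in> carrier A; c \<in> carrier A\<rbrakk> \<Longrightarrow> a \<odot>\<^bsub>Free\<^esub> free_term A c b = free_term A (a \<otimes> c) b"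
  by (auto simp: free_term_def)

text \<open>Finite support makes every element a sum of terms \<open>a[b]\<close>; the induction
  runs over a finite set containing the support and splits off one symbol at a time.\<close>

lemma Free_induct [consumes 1, case_names zero gen add]:
  assumes u: "u \<in> carrier Free"
    and zero: "P \<zero>\<^bsub>Free\<^esub>"
    and gen: "\<And>a b. \<lbrakk>a \<in> carrier A; b \<in> carrier A\<rbrakk> \<Longrightarrow> P (free_term A a b)"
    and add: "\<And>u v. \<lbrakk>u \<in> carrier Free; v \<in> carrier Free; P u; P v\<rbrakk> \<Longrightarrow> P (u \<oplus>\<^bsub>Free\<^esub> v)"
  shows "P u"
proof -
  have "P v" if "finite S" "S \<subseteq> carrier A" "v \<in> carrier Free" "{b. v b \<noteq> \<zero>} \<subseteq> S" for S v
    using that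
  proof (induction S arbitrary: v rule: finite_induct)
    case empty
    then have "v = \<zero>\<^bsub>Free\<^esub>"
      by auto
    then show ?case
      using zero by simp
  next
    case (insert b S)
    let ?w = "v(b := \<zero>)"
    have w: "?w \<in> carrier Free"
      by (rule Free_closed[where S = S]) (use insert in auto)
    have "P ?w"
      by (rule insert.IH[OF _ w]) (use insert in auto)
    moreover have "P (free_term A (v b) b)"
      using insert gen by auto
    moreover have "free_term A (v b) b \<in> carrier Free"
      using insert by auto
    ultimately have "P (free_term A (v b) b \<oplus>\<^bsub>Free\<^esub> ?w)"
      using w by (intro add)
    moreover have "v = free_term A (v b) b \<oplus>\<^bsub>Free\<^esub> ?w"
      using Free_apply[OF insert.prems(2)] by (auto simp: free_term_def)
    ultimately show ?case
      by (rule ssubst[where P = P, rotated])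
  qed
  then show ?thesis
    using Free_support[OF u] u by blast
qed

section \<open>Additive maps out of the free module\<close>

context
  fixes G :: "('m, 'w) ring_scheme" and g
  assumes G: "abelian_group G"
    and g_closed: "\<And>a b. \<lbrakk>a \<in> carrier A; b \<in> carrier A\<rbrakk> \<Longrightarrow> g a b \<in> carrier G"
    and g_add: "\<And>a a' b. \<lbrakk>a \<in> carrier A; a' \<in> carrier A; b \<in> carrier A\<rbrakk> \<Longrightarrow>
      g (a \<oplus> a') b = g a b \<oplus>\<^bsub>G\<^esub> g a' b"
begin

interpretation G: abelian_group G by (rule G)

lemma g_zero: "b \<in> carrier A \<Longrightarrow> g \<zero> b = \<zero>\<^bsub>G\<^esub>"
  by (rule abelian_group_hom.hom_zero[of A G "\<lambda>a. g a b"])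
     (auto intro!: abelian_group_hom_additiveI simp: A.abelian_group_axioms G g_closed g_add)

text \<open>Additivity gives \<open>g \<zero> b = \<zero>\<close>, so the support may be enlarged;
  the extension can then be evaluated at two elements and at their sum over one index set.\<close>

lemma additive_extension_eq:
  assumes "u \<in> carrier Free" "finite S" "S \<subseteq> carrier A" "{b. u b \<noteq> \<zero>} \<subseteq> S"
  shows "additive_extension A G g u = (\<Oplus>\<^bsub>G\<^esub>b\<in>S. g (u b) b)"
  unfolding additive_extension_def
  by (rule G.add.finprod_mono_neutral_cong_left) (use assms in \<open>auto simp: g_zero g_closed subset_iff\<close>)

lemma additive_extension_hom: "abelian_group_hom Free G (additive_extension A G g)"
proof (rule abelian_group_hom_additiveI[OF abelian_group_Free G])
  fix u v assume uv: "u \<in> carrier Free" "v \<in> carrier Free"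
  show "additive_extension A G g u \<in> carrier G"
    using uv Free_support[of u] unfolding additive_extension_def
    by (intro G.finsum_closed) (auto simp: g_closed)
  let ?S = "{b. u b \<noteq> \<zero>} \<union> {b. v b \<noteq> \<zero>}"
  have S: "finite ?S" "?S \<subseteq> carrier A"
    using uv Free_support by auto
  have "additive_extension A G g (u \<oplus>\<^bsub>Free\<^esub> v) = (\<Oplus>\<^bsub>G\<^esub>b\<in>?S. g (u b \<oplus> v b) b)"
    using uv S by (subst additive_extension_eq[where S = ?S]) auto
  also have "\<dots> = (\<Oplus>\<^bsub>G\<^esub>b\<in>?S. g (u b) b \<oplus>\<^bsub>G\<^esub> g (v b) b)"
    using uv S by (intro G.finsum_cong') (auto simp: g_add g_closed subset_iff)
  also have "\<dots> = (\<Oplus>\<^bsub>G\<^esub>b\<in>?S. g (u b) b) \<oplus>\<^bsub>G\<^esub> (\<Oplus>\<^bsub>G\<^esub>b\<in>?S. g (v b) b)"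
    using uv S by (intro G.finsum_addf) (auto simp: g_closed subset_iff)
  also have "\<dots> = additive_extension A G g u \<oplus>\<^bsub>G\<^esub> additive_extension A G g v"
    using uv S by (simp add: additive_extension_eq[where S = ?S])
  finally show "additive_extension A G g (u \<oplus>\<^bsub>Free\<^esub> v) =
    additive_extension A G g u \<oplus>\<^bsub>G\<^esub> additive_extension A G g v" .
qed

lemma additive_extension_term:
  assumes "a \<in> carrier A" "b \<in> carrier A"
  shows "additive_extension A G g (free_term A a b) = g a b"
  using assms
  by (subst additive_extension_eq[OF Free_term_closed, where S = "{b}"])
     (auto simp: free_term_def g_closed)

end

section \<open>The operator \<partial> on the free module\<close>

lemma free_partial_eq:
  "free_partial A D =
    additive_extension A Free (\<lambda>a b. free_term A (D a) b \<oplus>\<^bsub>Free\<^esub> free_term A a (D b))"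
  by (simp add: free_partial_def additive_extension_def fun_eq_iff)

text \<open>The additivity condition that \<open>additive_extension\<close> requires for
  \<open>a[b] \<mapsto> (\<partial>a)[b] + a[\<partial>b]\<close>; both
  \<open>free_partial_hom\<close> and \<open>free_partial_term\<close> use it.\<close>

lemma free_partial_term_add:
  assumes "a \<in> carrier A" "a' \<in> carrier A" "b \<in> carrier A"
  shows "free_term A (D (a \<oplus> a')) b \<oplus>\<^bsub>Free\<^esub> free_term A (a \<oplus> a') (D b) =
    (free_term A (D a) b \<oplus>\<^bsub>Free\<^esub> free_term A a (D b)) \<oplus>\<^bsub>Free\<^esub>
    (free_term A (D a') b \<oplus>\<^bsub>Free\<^esub> free_term A a' (D b))"
  using assms by (auto simp: free_term_def fun_eq_iff D_add A.a_ac)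

lemma free_partial_hom: "abelian_group_hom Free Free (free_partial A D)"
  unfolding free_partial_eq
  by (rule additive_extension_hom[OF abelian_group_Free _ free_partial_term_add]) auto

lemma free_partial_term:
  "\<lbrakk>a \<in> carrier A; b \<in> carrier A\<rbrakk> \<Longrightarrow> free_partial A D (free_term A a b) =
    free_term A (D a) b \<oplus>\<^bsub>Free\<^esub> free_term A a (D b)"
  unfolding free_partial_eq
  by (rule additive_extension_term[OF abelian_group_Free _ free_partial_term_add]) auto

text \<open>On a term \<open>c[b]\<close> this is the Leibniz rule of \<open>D\<close> for the
  product of \<open>a\<close> and \<open>c\<close>; both sides are additive in \<open>u\<close>,
  which gives the general case.\<close>

lemma free_partial_smult:
  assumes "u \<in> carrier Free" "a \<in> carrier A"
  shows "free_partial A D (a \<odot>\<^bsub>Free\<^esub> u) = D a \<odot>\<^bsub>Free\<^esub> u \<oplus>\<^bsub>Free\<^esub> a \<odot>\<^bsub>Free\<^esub> free_partial A D u"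
  using assms(1)
proof (induction u rule: Free_induct)
  case zero
  show ?case
    using assms abelian_group_hom.hom_zero[OF free_partial_hom] by simp
next
  case (gen c b)
  then show ?case
    using assms unfolding free_term_smult[OF assms(2) gen(1)]
    by (simp only: free_partial_term A.m_closed)
       (auto simp: free_term_def fun_eq_iff D_mult A.r_distr A.m_comm A.a_ac)
next
  case (add u v)
  interpret fp: abelian_group_hom Free Free "free_partial A D" by (rule free_partial_hom)
  interpret Fr: left_module A Free by (rule left_module_Free)
  have [simp]: "free_partial A D u \<in> carrier Free" "free_partial A D v \<in> carrier Free"
    using add by auto
  have "free_partial A D (a \<odot>\<^bsub>Free\<^esub> (u \<oplus>\<^bsub>Free\<^esub> v)) =
      (D a \<odot>\<^bsub>Free\<^esub> u \<oplus>\<^bsub>Free\<^esub> a \<odot>\<^bsub>Free\<^esub> free_partial A D u) \<oplus>\<^bsub>Free\<^esub>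
      (D a \<odot>\<^bsub>Free\<^esub> v \<oplus>\<^bsub>Free\<^esub> a \<odot>\<^bsub>Free\<^esub> free_partial A D v)"
    using add assms by (simp only: Fr.smult_r_distr fp.hom_add Fr.smult_closed)
  then show ?case
    using add assms
    by (simp only: fp.hom_add) (simp add: fun_eq_iff A.r_distr A.a_ac)
qed

end

locale algebra_derivation = differential_cring A D
  for F :: "('f, 'x) ring_scheme" and A :: "('f, 'a, 'y) module_scheme" (structure) and D +
  assumes algebra: "algebra F A"
    and D_smult: "\<lbrakk>c \<in> carrier F; a \<in> carrier A\<rbrakk> \<Longrightarrow> D (c \<odot>\<^bsub>A\<^esub> a) = c \<odot>\<^bsub>A\<^esub> D a"
begin

lemma scalar_closed [simp]:
  "\<lbrakk>c \<in> carrier F; a \<in> carrier A\<rbrakk> \<Longrightarrow> c \<odot>\<^bsub>A\<^esub> a \<in> carrier A"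
  by (rule module.smult_closed[OF algebra.module[OF algebra]])

lemma scalar_zero [simp]: "c \<in> carrier F \<Longrightarrow> c \<odot>\<^bsub>A\<^esub> \<zero> = \<zero>"
  by (rule module.smult_r_null[OF algebra.module[OF algebra]])

lemma scalar_mult: "\<lbrakk>c \<in> carrier F; a \<in> carrier A\<rbrakk> \<Longrightarrow> (c \<odot>\<^bsub>A\<^esub> \<one>) \<otimes> a = c \<odot>\<^bsub>A\<^esub> a"
  using algebra.smult_assoc2[OF algebra, of c \<one> a] by simp

text \<open>\<open>D\<close> is linear and kills \<open>\<one>\<close>, so scalars are constants of
  the derivation. Both the descent of \<partial> through the scalar relations and the commutation of
  \<open>F\<close> with \<open>A[\<partial>]\<close> rest on this.\<close>

lemma D_scalar: "c \<in> carrier F \<Longrightarrow> D (c \<odot>\<^bsub>A\<^esub> \<one>) = \<zero>"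
  by (metis A.m_comm A.one_closed A.r_null A.zero_closed D_one D_smult scalar_closed scalar_mult)

section \<open>The quotient by the defining relations\<close>

abbreviation N where "N \<equiv> kaehler_sub F A"

abbreviation K where "K \<equiv> kaehler F A"

abbreviation d where "d \<equiv> kaehler_d F A"

lemma kaehler_rels_subset: "kaehler_rels F A \<subseteq> carrier Free"
proof -
  interpret Fr: left_module A Free by (rule left_module_Free)
  show ?thesis
    unfolding kaehler_rels_def
    by (auto simp del: Free_simps intro!: Fr.M.minus_closed Fr.M.a_closed)
qed

lemma kaehler_sub_least: "\<lbrakk>submodule S A Free; kaehler_rels F A \<subseteq> S\<rbrakk> \<Longrightarrow> N \<subseteq> S"
  by (auto simp: kaehler_sub_def)

lemma kaehler_rels_sub: "kaehler_rels F A \<subseteq> N"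
  by (auto simp: kaehler_sub_def)

text \<open>The whole free module is one of the submodules intersected, so the intersection stays
  inside it; the closure properties pass to intersections.\<close>

lemma submodule_N: "submodule N A Free"
proof -
  interpret Fr: module A Free by (rule module_Free)
  note E = Fr.submoduleE
  show ?thesis
  proof (rule Fr.submoduleI)
    show "N \<subseteq> carrier Free"
      by (rule kaehler_sub_least[OF Fr.carrier_is_submodule kaehler_rels_subset])
    have "\<zero>\<^bsub>Free\<^esub> \<in> S" if "submodule S A Free" for S
      using subgroup.one_closed[OF submodule.axioms(1)[OF that]] by simp
    then show "\<zero>\<^bsub>Free\<^esub> \<in> N"
      by (auto simp: kaehler_sub_def)
  qed (auto simp: kaehler_sub_def simp del: Free_simps dest: E)
qed

lemma abelian_subgroup_N: "abelian_subgroup N Free"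
  by (rule abelian_subgroupI3[OF additive_subgroupI[OF submodule.axioms(1)[OF submodule_N]]
      abelian_group_Free])

lemma N_smult: "\<lbrakk>a \<in> carrier A; u \<in> N\<rbrakk> \<Longrightarrow> a \<odot>\<^bsub>Free\<^esub> u \<in> N"
  by (rule submodule.smult_closed[OF submodule_N])

interpretation N: abelian_subgroup N Free
  by (rule abelian_subgroup_N)

interpretation Fr: left_module A Free
  by (rule left_module_Free)

abbreviation cls where "cls u \<equiv> N +>\<^bsub>Free\<^esub> u"

lemma K_carrier: "carrier K = cls ` carrier Free"
  by (auto simp: kaehler_def A_RCOSETS_def')

lemma cls_closed [simp]: "u \<in> carrier Free \<Longrightarrow> cls u \<in> carrier K"
  by (simp add: K_carrier)

lemma K_cases:
  assumes "X \<in> carrier K"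
  obtains u where "u \<in> carrier Free" "X = cls u"
  using assms by (auto simp: K_carrier)

lemma cls_eq_iff:
  assumes "u \<in> carrier Free" "v \<in> carrier Free"
  shows "cls u = cls v \<longleftrightarrow> u \<ominus>\<^bsub>Free\<^esub> v \<in> N"
proof -
  have "cls u = cls v \<longleftrightarrow> u \<in> cls v"
    using assms N.a_rcos_self N.a_repr_independence' by metis
  then show ?thesis
    using assms N.a_rcos_module[of v u] unfolding a_minus_def by blast
qed

lemma cls_coset:
  assumes u: "u \<in> carrier Free" and x: "x \<in> cls u"
  shows "x \<in> carrier Free" "cls x = cls u" "\<exists>n\<in>N. x = n \<oplus>\<^bsub>Free\<^esub> u"
proof -
  show "x \<in> carrier Free"
    using u x by (rule N.a_elemrcos_carrier)
  show "cls x = cls u"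
    using N.a_repr_independence'[OF x u] by (rule sym)
  show "\<exists>n\<in>N. x = n \<oplus>\<^bsub>Free\<^esub> u"
    using x unfolding a_r_coset_def' by blast
qed

lemma cls_add_N: "\<lbrakk>n \<in> N; u \<in> carrier Free\<rbrakk> \<Longrightarrow> cls (n \<oplus>\<^bsub>Free\<^esub> u) = cls u"
  using cls_coset(2)[of u "n \<oplus>\<^bsub>Free\<^esub> u"] unfolding a_r_coset_def' by blast

text \<open>Representatives of one coset differ by elements of \<open>N\<close>, and an additive
  \<open>h\<close> preserving \<open>N\<close> sends them into one coset, so the union collapses.
  This serves both the scalar action and \<partial> on the quotient.\<close>

lemma induced_map:
  assumes "abelian_group_hom Free Free h" "h ` N \<subseteq> N" and u: "u \<in> carrier Free"
  shows "(\<Union>x\<in>cls u. cls (h x)) = cls (h u)"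
proof -
  interpret h: abelian_group_hom Free Free h by fact
  have "cls (h x) = cls (h u)" if x: "x \<in> cls u" for x
  proof -
    obtain n where n: "n \<in> N" "x = n \<oplus>\<^bsub>Free\<^esub> u"
      using cls_coset(3)[OF u x] by blast
    have "h x = h n \<oplus>\<^bsub>Free\<^esub> h u"
      unfolding n(2) by (rule h.hom_add[OF N.a_Hcarr[OF n(1)] u])
    moreover have "cls (h n \<oplus>\<^bsub>Free\<^esub> h u) = cls (h u)"
      by (rule cls_add_N) (use n(1) u assms(2) in blast, rule h.hom_closed[OF u])
    ultimately show ?thesis
      by simp
  qed
  then have "(\<Union>x\<in>cls u. cls (h x)) = (\<Union>x\<in>cls u. cls (h u))"
    by (intro SUP_cong refl)
  \<comment> \<open>The coset contains \<open>u\<close>, so the union of the constant family is that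
    constant.\<close>
  then show ?thesis
    using N.a_rcos_self[OF u] by (simp only: UN_constant) auto
qed

lemma cls_add:
  "\<lbrakk>u \<in> carrier Free; v \<in> carrier Free\<rbrakk> \<Longrightarrow> cls u \<oplus>\<^bsub>K\<^esub> cls v = cls (u \<oplus>\<^bsub>Free\<^esub> v)"
  unfolding kaehler_def ring.simps by (rule N.a_rcos_sum)

lemma cls_smult:
  assumes "a \<in> carrier A" "u \<in> carrier Free"
  shows "a \<odot>\<^bsub>K\<^esub> cls u = cls (a \<odot>\<^bsub>Free\<^esub> u)"
proof -
  have "(\<Union>x\<in>cls u. cls (a \<odot>\<^bsub>Free\<^esub> x)) = cls (a \<odot>\<^bsub>Free\<^esub> u)"
    by (rule induced_map[OF Fr.smult_hom]) (use assms N_smult in auto)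
  then show ?thesis
    by (simp add: kaehler_def)
qed

lemma cls_zero: "\<zero>\<^bsub>K\<^esub> = cls \<zero>\<^bsub>Free\<^esub>"
  using N.a_rcos_const[OF additive_subgroup.zero_closed[OF N.is_additive_subgroup]]
  by (simp add: kaehler_def del: Free_simps)

lemma abelian_group_K: "abelian_group K"
proof (rule abelian_groupI)
  fix X Y Z assume X: "X \<in> carrier K" and Y: "Y \<in> carrier K" and Z: "Z \<in> carrier K"
  obtain u v w where [simp]: "u \<in> carrier Free" "v \<in> carrier Free" "w \<in> carrier Free"
    and eq: "X = cls u" "Y = cls v" "Z = cls w"
    using X Y Z by (metis K_cases)
  show "X \<oplus>\<^bsub>K\<^esub> Y \<in> carrier K"
    by (simp add: eq cls_add del: Free_simps)
  show "(X \<oplus>\<^bsub>K\<^esub> Y) \<oplus>\<^bsub>K\<^esub> Z = X \<oplus>\<^bsub>K\<^esub> (Y \<oplus>\<^bsub>K\<^esub> Z)"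
    by (simp add: eq cls_add N.a_assoc del: Free_simps)
next
  fix X Y assume X: "X \<in> carrier K" and Y: "Y \<in> carrier K"
  obtain u v where [simp]: "u \<in> carrier Free" "v \<in> carrier Free"
    and eq: "X = cls u" "Y = cls v"
    using X Y by (metis K_cases)
  show "X \<oplus>\<^bsub>K\<^esub> Y = Y \<oplus>\<^bsub>K\<^esub> X"
    by (simp add: eq cls_add N.a_comm del: Free_simps)
  show "\<zero>\<^bsub>K\<^esub> \<oplus>\<^bsub>K\<^esub> X = X"
    by (simp add: eq cls_add cls_zero del: Free_simps)
  have "cls (\<ominus>\<^bsub>Free\<^esub> u) \<oplus>\<^bsub>K\<^esub> X = \<zero>\<^bsub>K\<^esub>"
    by (simp add: eq cls_add cls_zero N.l_neg del: Free_simps)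
  then show "\<exists>Y\<in>carrier K. Y \<oplus>\<^bsub>K\<^esub> X = \<zero>\<^bsub>K\<^esub>"
    by (rule bexI) (rule cls_closed[OF abelian_group.a_inv_closed[OF abelian_group_Free]], simp)
qed (simp add: cls_zero del: Free_simps)

lemma left_module_K: "left_module A K"
proof (intro left_module.intro left_module_axioms.intro A.ring_axioms abelian_group_K)
  fix a b X Y assume X: "X \<in> carrier K" and Y: "Y \<in> carrier K"
    and [simp]: "a \<in> carrier A" "b \<in> carrier A"
  obtain u v where [simp]: "u \<in> carrier Free" "v \<in> carrier Free"
    and eq: "X = cls u" "Y = cls v"
    using X Y by (metis K_cases)
  show "a \<odot>\<^bsub>K\<^esub> X \<in> carrier K"
    by (simp add: eq cls_smult del: Free_simps)
  show "(a \<oplus> b) \<odot>\<^bsub>K\<^esub> X = a \<odot>\<^bsub>K\<^esub> X \<oplus>\<^bsub>K\<^esub> b \<odot>\<^bsub>K\<^esub> X"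
    by (simp add: eq cls_smult cls_add Fr.smult_l_distr del: Free_simps)
  show "a \<odot>\<^bsub>K\<^esub> (X \<oplus>\<^bsub>K\<^esub> Y) = a \<odot>\<^bsub>K\<^esub> X \<oplus>\<^bsub>K\<^esub> a \<odot>\<^bsub>K\<^esub> Y"
    by (simp add: eq cls_smult cls_add Fr.smult_r_distr del: Free_simps)
  show "(a \<otimes> b) \<odot>\<^bsub>K\<^esub> X = a \<odot>\<^bsub>K\<^esub> (b \<odot>\<^bsub>K\<^esub> X)"
    by (simp add: eq cls_smult Fr.smult_assoc del: Free_simps)
next
  fix X assume "X \<in> carrier K"
  then obtain u where "u \<in> carrier Free" "X = cls u"
    by (rule K_cases)
  then show "\<one> \<odot>\<^bsub>K\<^esub> X = X"
    by (simp add: cls_smult del: Free_simps)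
qed

interpretation K: left_module A K
  by (rule left_module_K)

section \<open>The differential and its relations\<close>

lemma d_closed [simp]: "a \<in> carrier A \<Longrightarrow> d a \<in> carrier K"
  by (simp add: kaehler_d_def)

lemma cls_term:
  "\<lbrakk>a \<in> carrier A; b \<in> carrier A\<rbrakk> \<Longrightarrow> cls (free_term A a b) = a \<odot>\<^bsub>K\<^esub> d b"
  unfolding kaehler_d_def
  by (subst cls_smult) (simp_all add: free_term_smult del: Free_simps)

lemma cls_term_add:
  assumes "a \<in> carrier A" "b \<in> carrier A" "a' \<in> carrier A" "b' \<in> carrier A"
  shows "cls (free_term A a b \<oplus>\<^bsub>Free\<^esub> free_term A a' b') = a \<odot>\<^bsub>K\<^esub> d b \<oplus>\<^bsub>K\<^esub> a' \<odot>\<^bsub>K\<^esub> d b'"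
  unfolding cls_term[OF assms(1,2), symmetric] cls_term[OF assms(3,4), symmetric]
  by (rule cls_add[symmetric]) (use assms in simp_all)

text \<open>The terms \<open>a[b]\<close> span the free module additively, so their classes
  \<open>a db\<close> span the quotient.\<close>

lemma K_induct [consumes 1, case_names zero gen add]:
  assumes X: "X \<in> carrier K"
    and zero: "P \<zero>\<^bsub>K\<^esub>"
    and gen: "\<And>a b. \<lbrakk>a \<in> carrier A; b \<in> carrier A\<rbrakk> \<Longrightarrow> P (a \<odot>\<^bsub>K\<^esub> d b)"
    and add: "\<And>X Y. \<lbrakk>X \<in> carrier K; Y \<in> carrier K; P X; P Y\<rbrakk> \<Longrightarrow> P (X \<oplus>\<^bsub>K\<^esub> Y)"
  shows "P X"
proof -
  obtain u where "u \<in> carrier Free" "X = cls u"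
    using X by (rule K_cases)
  moreover have "P (cls u)" if "u \<in> carrier Free" for u
    using that
  proof (induction u rule: Free_induct)
    case zero
    then show ?case
      using assms(2) by (simp only: cls_zero)
  next
    case (gen a b)
    then show ?case
      using assms(3) by (simp only: cls_term)
  next
    case (add u v)
    then show ?case
      using assms(4)[of "cls u" "cls v"] by (simp only: cls_add cls_closed)
  qed
  ultimately show ?thesis
    by simp
qed

lemma kaehler_relsE:
  assumes "r \<in> kaehler_rels F A"
  obtains (add) a b where "a \<in> carrier A" "b \<in> carrier A"
      "r = free_gen A (a \<oplus> b) \<ominus>\<^bsub>Free\<^esub> (free_gen A a \<oplus>\<^bsub>Free\<^esub> free_gen A b)"
    | (scalar) c a where "c \<in> carrier F" "a \<in> carrier A"
      "r = free_gen A (c \<odot>\<^bsub>A\<^esub> a) \<ominus>\<^bsub>Free\<^esub> free_term A (c \<odot>\<^bsub>A\<^esub> \<one>) a"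
    | (mult) a b where "a \<in> carrier A" "b \<in> carrier A"
      "r = free_gen A (a \<otimes> b) \<ominus>\<^bsub>Free\<^esub> (free_term A a b \<oplus>\<^bsub>Free\<^esub> free_term A b a)"
  using assms unfolding kaehler_rels_def by blast

lemma cls_eqI: "\<lbrakk>u \<ominus>\<^bsub>Free\<^esub> v \<in> N; u \<in> carrier Free; v \<in> carrier Free\<rbrakk> \<Longrightarrow> cls u = cls v"
  by (simp only: cls_eq_iff)

text \<open>The defining relation lies in \<open>N\<close>, so its two sides have the same class;
  \<open>d_scalar\<close> and \<open>d_mult\<close> are read off the other two families in the same
  way.\<close>

lemma d_add:
  assumes "a \<in> carrier A" "b \<in> carrier A"
  shows "d (a \<oplus> b) = d a \<oplus>\<^bsub>K\<^esub> d b"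
proof -
  have "free_gen A (a \<oplus> b) \<ominus>\<^bsub>Free\<^esub> (free_gen A a \<oplus>\<^bsub>Free\<^esub> free_gen A b) \<in> N"
    by (rule subsetD[OF kaehler_rels_sub]) (use assms in \<open>auto simp: kaehler_rels_def simp del: Free_simps\<close>)
  then have "d (a \<oplus> b) = cls (free_gen A a \<oplus>\<^bsub>Free\<^esub> free_gen A b)"
    unfolding kaehler_d_def by (rule cls_eqI) (use assms in simp_all)
  also have "\<dots> = d a \<oplus>\<^bsub>K\<^esub> d b"
    unfolding kaehler_d_def by (rule cls_add[symmetric]) (use assms in simp_all)
  finally show ?thesis .
qed

lemma d_scalar:
  assumes "c \<in> carrier F" "a \<in> carrier A"
  shows "d (c \<odot>\<^bsub>A\<^esub> a) = (c \<odot>\<^bsub>A\<^esub> \<one>) \<odot>\<^bsub>K\<^esub> d a"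
proof -
  have "free_gen A (c \<odot>\<^bsub>A\<^esub> a) \<ominus>\<^bsub>Free\<^esub> free_term A (c \<odot>\<^bsub>A\<^esub> \<one>) a \<in> N"
    by (rule subsetD[OF kaehler_rels_sub]) (use assms in \<open>auto simp: kaehler_rels_def simp del: Free_simps\<close>)
  then have "d (c \<odot>\<^bsub>A\<^esub> a) = cls (free_term A (c \<odot>\<^bsub>A\<^esub> \<one>) a)"
    unfolding kaehler_d_def by (rule cls_eqI) (use assms in simp_all)
  also have "\<dots> = (c \<odot>\<^bsub>A\<^esub> \<one>) \<odot>\<^bsub>K\<^esub> d a"
    by (rule cls_term) (use assms in simp_all)
  finally show ?thesis .
qed

lemma d_mult:
  assumes "a \<in> carrier A" "b \<in> carrier A"
  shows "d (a \<otimes> b) = a \<odot>\<^bsub>K\<^esub> d b \<oplus>\<^bsub>K\<^esub> b \<odot>\<^bsub>K\<^esub> d a"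
proof -
  have "free_gen A (a \<otimes> b) \<ominus>\<^bsub>Free\<^esub> (free_term A a b \<oplus>\<^bsub>Free\<^esub> free_term A b a) \<in> N"
    by (rule subsetD[OF kaehler_rels_sub], unfold kaehler_rels_def) (rule UnI2, use assms in blast)
  then have "d (a \<otimes> b) = cls (free_term A a b \<oplus>\<^bsub>Free\<^esub> free_term A b a)"
    unfolding kaehler_d_def by (rule cls_eqI) (use assms in simp_all)
  also have "\<dots> = a \<odot>\<^bsub>K\<^esub> d b \<oplus>\<^bsub>K\<^esub> b \<odot>\<^bsub>K\<^esub> d a"
    by (rule cls_term_add) (use assms in simp_all)
  finally show ?thesis .
qed

section \<open>Descent of \<partial> to the quotient\<close>

lemma cls_free_partial_term:
  assumes "a \<in> carrier A" "b \<in> carrier A"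
  shows "cls (free_partial A D (free_term A a b)) = D a \<odot>\<^bsub>K\<^esub> d b \<oplus>\<^bsub>K\<^esub> a \<odot>\<^bsub>K\<^esub> d (D b)"
  unfolding free_partial_term[OF assms] by (rule cls_term_add) (use assms in simp_all)

lemma cls_free_partial_gen:
  "b \<in> carrier A \<Longrightarrow> cls (free_partial A D (free_gen A b)) = d (D b)"
  using cls_free_partial_term[of \<one> b] by simp

text \<open>\<open>N\<close> is the least submodule containing the relations, so it suffices that
  the elements of \<open>N\<close> sent into \<open>N\<close> form a submodule containing
  them.\<close>

lemma free_partial_N: "free_partial A D ` N \<subseteq> N"
proof -
  interpret fp: abelian_group_hom Free Free "free_partial A D"
    by (rule free_partial_hom)
  interpret Frm: module A Free
    by (rule module_Free)
  \<comment> \<open>Membership of \<open>u\<close> in \<open>N\<close> is part of the condition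
    because \<partial> is not \<open>A\<close>-linear: \<open>\<partial>(a u)\<close> contains the
    term \<open>(\<partial>a) u\<close>.\<close>
  let ?S = "{u \<in> N. free_partial A D u \<in> N}"
  have "submodule ?S A Free"
  proof (rule Frm.submoduleI)
    fix a u assume a: "a \<in> carrier A" and u: "u \<in> ?S"
    then have "free_partial A D (a \<odot>\<^bsub>Free\<^esub> u) =
        D a \<odot>\<^bsub>Free\<^esub> u \<oplus>\<^bsub>Free\<^esub> a \<odot>\<^bsub>Free\<^esub> free_partial A D u"
      by (intro free_partial_smult) auto
    then show "a \<odot>\<^bsub>Free\<^esub> u \<in> ?S"
      using a u N_smult N.a_closed by (simp del: Free_simps)
  qed (auto simp del: Free_simps)
  moreover have "kaehler_rels F A \<subseteq> ?S"
  proof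
    fix r assume r: "r \<in> kaehler_rels F A"
    \<comment> \<open>Turns membership of \<open>\<partial>(x - y)\<close> in \<open>N\<close> into
      an equality of classes, so that the laws already proved for \<open>d\<close> apply to each
      relation.\<close>
    have minus: "free_partial A D (x \<ominus>\<^bsub>Free\<^esub> y) \<in> N"
      if "x \<in> carrier Free" "y \<in> carrier Free"
        and "cls (free_partial A D x) = cls (free_partial A D y)" for x y
    proof -
      have "free_partial A D (x \<ominus>\<^bsub>Free\<^esub> y) = free_partial A D x \<ominus>\<^bsub>Free\<^esub> free_partial A D y"
        using that by (simp add: a_minus_def del: Free_simps)
      then show ?thesis
        using that cls_eq_iff[of "free_partial A D x" "free_partial A D y"] by simp
    qed
    have plus: "cls (free_partial A D (x \<oplus>\<^bsub>Free\<^esub> y)) =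
        cls (free_partial A D x) \<oplus>\<^bsub>K\<^esub> cls (free_partial A D y)"
      if "x \<in> carrier Free" "y \<in> carrier Free" for x y
      unfolding fp.hom_add[OF that] by (rule cls_add[symmetric]) (use that in simp_all)
    have "free_partial A D r \<in> N"
      using r
    proof (cases rule: kaehler_relsE)
      case (add a b)
      then show ?thesis
        unfolding add(3)
        by (intro minus) (simp_all add: plus cls_free_partial_gen D_add d_add del: Free_simps fp.hom_add)
    next
      \<comment> \<open>\<open>D_scalar\<close> removes the term
        \<open>\<partial>(c \<one>) da\<close>; both sides then give
        \<open>(c \<one>) d(\<partial>a)\<close>.\<close>
      case (scalar c a)
      then show ?thesis
        unfolding scalar(3)
        by (intro minus)
           (simp_all add: cls_free_partial_gen cls_free_partial_term D_smult D_scalar d_scalar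
             del: Free_simps)
    next
      \<comment> \<open>The four terms of \<open>d(\<partial>(a b))\<close> are, up to order, those
        obtained by applying \<partial> to \<open>a db + b da\<close>.\<close>
      case (mult a b)
      then have "cls (free_partial A D (free_gen A (a \<otimes> b))) =
          (a \<odot>\<^bsub>K\<^esub> d (D b) \<oplus>\<^bsub>K\<^esub> D b \<odot>\<^bsub>K\<^esub> d a) \<oplus>\<^bsub>K\<^esub> (b \<odot>\<^bsub>K\<^esub> d (D a) \<oplus>\<^bsub>K\<^esub> D a \<odot>\<^bsub>K\<^esub> d b)"
        by (simp add: cls_free_partial_gen D_mult d_add d_mult)
      also have "\<dots> = cls (free_partial A D (free_term A a b \<oplus>\<^bsub>Free\<^esub> free_term A b a))"
        using mult by (simp add: plus cls_free_partial_term K.M.a_ac del: Free_simps fp.hom_add)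
      finally show ?thesis
        unfolding mult(3) using mult by (intro minus) (simp_all del: Free_simps)
    qed
    then show "r \<in> ?S"
      using r kaehler_rels_sub by blast
  qed
  ultimately show ?thesis
    using kaehler_sub_least[of ?S] by blast
qed

abbreviation Q where "Q \<equiv> kaehler_partial F A D"

lemma Q_cls: "u \<in> carrier Free \<Longrightarrow> Q (cls u) = cls (free_partial A D u)"
  unfolding kaehler_partial_def by (rule induced_map[OF free_partial_hom free_partial_N])

lemma Q_d: "a \<in> carrier A \<Longrightarrow> Q (d a) = d (D a)"
  using Q_cls[of "free_gen A a"] cls_free_partial_gen[of a] by (simp add: kaehler_d_def)

lemma differential_module_K: "differential_module A D K Q"
proof (intro differential_module.intro differential_module_axioms.intro differential_cring_axioms left_module_K)
  interpret fp: abelian_group_hom Free Free "free_partial A D"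
    by (rule free_partial_hom)
  fix X assume "X \<in> carrier K"
  then obtain u where u: "u \<in> carrier Free" "X = cls u"
    by (rule K_cases)
  show "Q X \<in> carrier K"
    using u by (simp add: Q_cls)
  show "Q (X \<oplus>\<^bsub>K\<^esub> Y) = Q X \<oplus>\<^bsub>K\<^esub> Q Y" if "Y \<in> carrier K" for Y
    using that u by (elim K_cases) (simp add: Q_cls cls_add del: Free_simps)
  show "Q (a \<odot>\<^bsub>K\<^esub> X) = D a \<odot>\<^bsub>K\<^esub> X \<oplus>\<^bsub>K\<^esub> a \<odot>\<^bsub>K\<^esub> Q X" if "a \<in> carrier A" for a
    using that u by (simp add: Q_cls cls_add cls_smult free_partial_smult del: Free_simps)
qed

lemma Omega_eq: "Omega F A D = ops_module A K Q"
  by (simp add: Omega_def ops_module_def)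

section \<open>The universal property\<close>

text \<open>Evaluates at an arbitrary representative of the coset; \<open>lift_cls\<close> shows
  that the choice does not matter.\<close>

definition kaehler_lift :: "('a, 'v, 'w) module_scheme \<Rightarrow> ('a \<Rightarrow> 'v) \<Rightarrow> ('a \<Rightarrow> 'a) set \<Rightarrow> 'v" where
  "kaehler_lift V \<delta> X = additive_extension A V (\<lambda>a b. a \<odot>\<^bsub>V\<^esub> \<delta> b) (SOME u. u \<in> X)"

context
  fixes V :: "('a, 'v, 'w) module_scheme" and \<delta>
  assumes V: "left_module A V" and \<delta>: "derivation F A V \<delta>"
begin

interpretation V: left_module A V
  by (rule V)

abbreviation lin where "lin \<equiv> additive_extension A V (\<lambda>a b. a \<odot>\<^bsub>V\<^esub> \<delta> b)"

lemma der_closed [simp]: "a \<in> carrier A \<Longrightarrow> \<delta> a \<in> carrier V"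
  using \<delta> by (auto simp: derivation_def)

lemma lin_hom: "abelian_group_hom Free V lin"
  by (rule additive_extension_hom) (auto simp: V.smult_l_distr V.M.abelian_group_axioms)

interpretation lin: abelian_group_hom Free V lin
  by (rule lin_hom)

lemma lin_term: "\<lbrakk>a \<in> carrier A; b \<in> carrier A\<rbrakk> \<Longrightarrow> lin (free_term A a b) = a \<odot>\<^bsub>V\<^esub> \<delta> b"
  by (rule additive_extension_term) (auto simp: V.smult_l_distr V.M.abelian_group_axioms)

lemma lin_smult:
  assumes "u \<in> carrier Free" and a: "a \<in> carrier A"
  shows "lin (a \<odot>\<^bsub>Free\<^esub> u) = a \<odot>\<^bsub>V\<^esub> lin u"
  using assms(1)
proof (induction u rule: Free_induct)
  case zero
  then show ?case
    using a by (simp del: Free_simps)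
next
  case (gen c b)
  then show ?case
    using a by (simp add: free_term_smult lin_term V.smult_assoc del: Free_simps)
next
  case (add u v)
  then show ?case
    using a by (simp add: V.smult_r_distr Fr.smult_r_distr del: Free_simps)
qed

text \<open>The kernel of \<open>lin\<close> is a submodule, and each family of relations vanishes
  under \<open>lin\<close> by the corresponding clause of \<open>derivation\<close>; minimality of
  \<open>N\<close> does the rest.\<close>

lemma lin_N: "u \<in> N \<Longrightarrow> lin u = \<zero>\<^bsub>V\<^esub>"
proof -
  interpret Frm: module A Free
    by (rule module_Free)
  let ?S = "{u \<in> carrier Free. lin u = \<zero>\<^bsub>V\<^esub>}"
  have "submodule ?S A Free"
    by (rule Frm.submoduleI) (auto simp: lin_smult simp del: Free_simps)
  moreover have "kaehler_rels F A \<subseteq> ?S"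
  proof
    fix r assume r: "r \<in> kaehler_rels F A"
    have minus: "lin (x \<ominus>\<^bsub>Free\<^esub> y) = \<zero>\<^bsub>V\<^esub>"
      if "x \<in> carrier Free" "y \<in> carrier Free" "lin x = lin y" for x y
      using that by (simp add: a_minus_def V.M.r_neg del: Free_simps)
    have "lin r = \<zero>\<^bsub>V\<^esub>"
      using r \<delta>
      by (cases rule: kaehler_relsE)
         (auto intro!: minus simp: lin_term derivation_def simp del: Free_simps)
    then show "r \<in> ?S"
      using r kaehler_rels_subset by blast
  qed
  ultimately show "lin u = \<zero>\<^bsub>V\<^esub>" if "u \<in> N"
    using kaehler_sub_least[of ?S] that by blast
qed

text \<open>The chosen representative differs from \<open>u\<close> by an element of
  \<open>N\<close>, which \<open>lin\<close> kills.\<close>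

lemma lift_cls:
  assumes u: "u \<in> carrier Free"
  shows "kaehler_lift V \<delta> (cls u) = lin u"
proof -
  have "(SOME x. x \<in> cls u) \<in> cls u"
    using N.a_rcos_self[OF u] by (rule someI[where P = "\<lambda>x. x \<in> cls u"])
  then obtain n where n: "n \<in> N" "(SOME x. x \<in> cls u) = n \<oplus>\<^bsub>Free\<^esub> u"
    using cls_coset(3)[OF u] by blast
  then show ?thesis
    using u by (simp add: kaehler_lift_def lin_N del: Free_simps)
qed

lemma lift_closed: "X \<in> carrier K \<Longrightarrow> kaehler_lift V \<delta> X \<in> carrier V"
  by (elim K_cases) (simp add: lift_cls)

lemma lift_add:
  "\<lbrakk>X \<in> carrier K; Y \<in> carrier K\<rbrakk> \<Longrightarrow>
    kaehler_lift V \<delta> (X \<oplus>\<^bsub>K\<^esub> Y) = kaehler_lift V \<delta> X \<oplus>\<^bsub>V\<^esub> kaehler_lift V \<delta> Y"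
  by (elim K_cases) (simp add: lift_cls cls_add del: Free_simps)

lemma lift_smult:
  "\<lbrakk>a \<in> carrier A; X \<in> carrier K\<rbrakk> \<Longrightarrow>
    kaehler_lift V \<delta> (a \<odot>\<^bsub>K\<^esub> X) = a \<odot>\<^bsub>V\<^esub> kaehler_lift V \<delta> X"
  by (elim K_cases) (simp add: lift_cls cls_smult lin_smult del: Free_simps)

lemma lift_d: "a \<in> carrier A \<Longrightarrow> kaehler_lift V \<delta> (d a) = \<delta> a"
  unfolding kaehler_d_def by (simp add: lift_cls lin_term)

end

end

section \<open>Derivations and homomorphisms\<close>

text \<open>The identity \<open>\<partial> \<circ> a = (\<partial>a) + a \<circ> \<partial>\<close>
  of \<open>A[\<partial>]\<close>, applied to \<open>x\<close>: the Leibniz rule for \<partial> on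
  any left \<open>A[\<partial>]\<close>-module.\<close>

lemma (in differential_cring) partial_smult:
  assumes M: "left_module Ops M" and a: "a \<in> carrier A" and x: "x \<in> carrier M"
  shows "monom Ops \<one> 1 \<odot>\<^bsub>M\<^esub> (monom Ops a 0 \<odot>\<^bsub>M\<^esub> x) =
    monom Ops (D a) 0 \<odot>\<^bsub>M\<^esub> x \<oplus>\<^bsub>M\<^esub> monom Ops a 0 \<odot>\<^bsub>M\<^esub> (monom Ops \<one> 1 \<odot>\<^bsub>M\<^esub> x)"
proof -
  interpret M: left_module Ops M by fact
  have mo: "monom Ops b i \<in> carrier Ops" if "b \<in> carrier A" for b i
    using that by simp
  have "monom Ops \<one> 1 \<otimes>\<^bsub>Ops\<^esub> monom Ops a 0 = pc (monom Ops a 0)"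
    using a by (intro partial_mult) simp
  also have "\<dots> = monom Ops (D a) 0 \<oplus>\<^bsub>Ops\<^esub> (\<lambda>i. a \<otimes> monom Ops \<one> 1 i)"
    using a by (auto simp: partial_comp_def fun_eq_iff)
  also have "(\<lambda>i. a \<otimes> monom Ops \<one> 1 i) = monom Ops a 0 \<otimes>\<^bsub>Ops\<^esub> monom Ops \<one> 1"
    using a by (intro const_mult[symmetric]) simp_all
  finally have eq: "monom Ops \<one> 1 \<otimes>\<^bsub>Ops\<^esub> monom Ops a 0 =
      monom Ops (D a) 0 \<oplus>\<^bsub>Ops\<^esub> monom Ops a 0 \<otimes>\<^bsub>Ops\<^esub> monom Ops \<one> 1" .
  have "monom Ops \<one> 1 \<odot>\<^bsub>M\<^esub> (monom Ops a 0 \<odot>\<^bsub>M\<^esub> x) =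
      (monom Ops \<one> 1 \<otimes>\<^bsub>Ops\<^esub> monom Ops a 0) \<odot>\<^bsub>M\<^esub> x"
    by (rule M.smult_assoc[symmetric]) (rule mo a x A.one_closed)+
  also have "\<dots> = monom Ops (D a) 0 \<odot>\<^bsub>M\<^esub> x \<oplus>\<^bsub>M\<^esub> (monom Ops a 0 \<otimes>\<^bsub>Ops\<^esub> monom Ops \<one> 1) \<odot>\<^bsub>M\<^esub> x"
    unfolding eq by (rule M.smult_l_distr) (rule mo a x A.one_closed D_closed M.R.m_closed)+
  also have "(monom Ops a 0 \<otimes>\<^bsub>Ops\<^esub> monom Ops \<one> 1) \<odot>\<^bsub>M\<^esub> x =
      monom Ops a 0 \<odot>\<^bsub>M\<^esub> (monom Ops \<one> 1 \<odot>\<^bsub>M\<^esub> x)"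
    by (rule M.smult_assoc) (rule mo a x A.one_closed)+
  finally show ?thesis .
qed

locale kaehler_universal = algebra_derivation F A D + M: left_module "diff_ops A D" M
  for F :: "('f, 'x) ring_scheme" and A :: "('f, 'a, 'y) module_scheme" (structure) and D
    and M :: "(nat \<Rightarrow> 'a, 'm, 'z) module_scheme"
begin

abbreviation \<Omega> where "\<Omega> \<equiv> Omega F A D"

abbreviation act :: "'a \<Rightarrow> 'm \<Rightarrow> 'm" (infixr \<open>\<bullet>\<close> 75)
  where "a \<bullet> x \<equiv> monom Ops a 0 \<odot>\<^bsub>M\<^esub> x"

abbreviation del :: "'m \<Rightarrow> 'm"
  where "del x \<equiv> monom Ops \<one> 1 \<odot>\<^bsub>M\<^esub> x"

interpretation dm: differential_module A D K Q
  by (rule differential_module_K)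

lemma left_module_M: "left_module Ops M"
  by (rule M.left_module_axioms)

lemma monom_Ops_closed: "a \<in> carrier A \<Longrightarrow> monom Ops a i \<in> carrier Ops"
  by simp

lemma act_closed: "\<lbrakk>a \<in> carrier A; x \<in> carrier M\<rbrakk> \<Longrightarrow> a \<bullet> x \<in> carrier M"
  by (rule M.smult_closed[OF monom_Ops_closed])

lemma del_closed: "x \<in> carrier M \<Longrightarrow> del x \<in> carrier M"
  by (rule M.smult_closed[OF monom_Ops_closed[OF A.one_closed]])

lemma act_add:
  "\<lbrakk>a \<in> carrier A; x \<in> carrier M; y \<in> carrier M\<rbrakk> \<Longrightarrow> a \<bullet> (x \<oplus>\<^bsub>M\<^esub> y) = a \<bullet> x \<oplus>\<^bsub>M\<^esub> a \<bullet> y"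
  by (rule M.smult_r_distr[OF monom_Ops_closed])

lemma del_add:
  "\<lbrakk>x \<in> carrier M; y \<in> carrier M\<rbrakk> \<Longrightarrow> del (x \<oplus>\<^bsub>M\<^esub> y) = del x \<oplus>\<^bsub>M\<^esub> del y"
  by (rule M.smult_r_distr[OF monom_Ops_closed[OF A.one_closed]])

text \<open>The element \<open>c \<odot> \<one>\<close> is killed by \<open>D\<close>, hence central
  in \<open>A[\<partial>]\<close>. Closure of \<open>Der\<close> and \<open>Hom\<close> under
  scalars of \<open>F\<close> depends on this.\<close>

lemma scalar_commutes:
  assumes c: "c \<in> carrier F" and p: "p \<in> carrier Ops" and x: "x \<in> carrier M"
  shows "(c \<odot>\<^bsub>A\<^esub> \<one>) \<bullet> (p \<odot>\<^bsub>M\<^esub> x) = p \<odot>\<^bsub>M\<^esub> ((c \<odot>\<^bsub>A\<^esub> \<one>) \<bullet> x)"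
proof -
  have c1: "c \<odot>\<^bsub>A\<^esub> \<one> \<in> carrier A"
    using c by simp
  have "p \<otimes>\<^bsub>Ops\<^esub> monom Ops (c \<odot>\<^bsub>A\<^esub> \<one>) 0 = monom Ops (c \<odot>\<^bsub>A\<^esub> \<one>) 0 \<otimes>\<^bsub>Ops\<^esub> p"
    using c p by (intro const_commutes) (simp_all only: D_scalar Ops_simps c1)
  then show ?thesis
    using M.smult_assoc[OF p monom_Ops_closed[OF c1] x, of 0]
      M.smult_assoc[OF monom_Ops_closed[OF c1] p x, of 0] by (simp only:)
qed

section \<open>\<open>M\<close> as a module over \<open>A\<close> and over \<open>F\<close>\<close>

abbreviation MA where "MA \<equiv> as_A_module A D M"

abbreviation MF where "MF \<equiv> as_F_module A D M"

lemma MA_simps [simp]: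
  "carrier MA = carrier M" "zero MA = zero M" "add MA = add M"
  "smult MA a x = a \<bullet> x"
  by (simp_all only: as_A_module_def restrict_scalars_simps)

lemma MF_simps [simp]:
  "carrier MF = carrier M" "zero MF = zero M" "add MF = add M"
  "smult MF c x = (c \<odot>\<^bsub>A\<^esub> \<one>) \<bullet> x"
  by (simp_all only: as_F_module_def restrict_scalars_simps)

lemma left_module_MA: "left_module A MA"
  unfolding as_A_module_def
  by (rule M.restrict_scalars_left_module[OF A.ring_axioms const_ring_hom])

lemma left_module_MF: "left_module F MF"
  unfolding as_F_module_def
proof (rule M.restrict_scalars_left_module)
  have F: "module F A"
    by (rule algebra.module[OF algebra])
  show "ring F"
    using F by (simp add: module_def cring_def)
  have "(\<lambda>c. c \<odot>\<^bsub>A\<^esub> \<one>) \<in> ring_hom F A"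
    using module.smult_l_distr[OF F] module.smult_one[OF F] module.smult_assoc1[OF F]
    by (intro ring_hom_memI) (simp_all add: scalar_mult)
  from ring_hom_trans[OF this const_ring_hom]
  show "(\<lambda>c. monom Ops (c \<odot>\<^bsub>A\<^esub> \<one>) 0) \<in> ring_hom F Ops"
    by (simp add: o_def)
qed

lemma partial_derivation_iff:
  "partial_derivation F A D M \<delta> \<longleftrightarrow> \<delta> \<in> carrier A \<rightarrow> carrier M \<and>
     (\<forall>a\<in>carrier A. \<forall>b\<in>carrier A. \<delta> (a \<oplus> b) = \<delta> a \<oplus>\<^bsub>M\<^esub> \<delta> b) \<and>
     (\<forall>c\<in>carrier F. \<forall>a\<in>carrier A. \<delta> (c \<odot>\<^bsub>A\<^esub> a) = (c \<odot>\<^bsub>A\<^esub> \<one>) \<bullet> \<delta> a) \<and>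
     (\<forall>a\<in>carrier A. \<forall>b\<in>carrier A. \<delta> (a \<otimes> b) = a \<bullet> \<delta> b \<oplus>\<^bsub>M\<^esub> b \<bullet> \<delta> a) \<and>
     (\<forall>a\<in>carrier A. \<delta> (D a) = del (\<delta> a))"
  unfolding partial_derivation_def derivation_def MA_simps by blast

section \<open>\<Omega>(A) over \<open>A[\<partial>]\<close> and the lift of a derivation\<close>

lemma Omega_simps [simp]:
  "carrier \<Omega> = carrier K" "zero \<Omega> = zero K" "add \<Omega> = add K"
  by (simp_all add: Omega_eq)

lemma Omega_const: "\<lbrakk>a \<in> carrier A; X \<in> carrier K\<rbrakk> \<Longrightarrow> monom Ops a 0 \<odot>\<^bsub>\<Omega>\<^esub> X = a \<odot>\<^bsub>K\<^esub> X"
  unfolding Omega_eq by (rule dm.act_const)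

lemma Omega_partial: "X \<in> carrier K \<Longrightarrow> monom Ops \<one> 1 \<odot>\<^bsub>\<Omega>\<^esub> X = Q X"
  unfolding Omega_eq by (rule dm.act_partial)

lemma left_module_Omega: "left_module Ops \<Omega>"
  unfolding Omega_eq by (rule dm.left_module_Act[OF M.R.ring_axioms])

text \<open>Restricted to the carrier so that its values lie in \<open>Hom\<close>, whose elements
  are extensional functions.\<close>

definition lift :: "('a \<Rightarrow> 'm) \<Rightarrow> ('a \<Rightarrow> 'a) set \<Rightarrow> 'm" where
  "lift \<delta> = (\<lambda>X\<in>carrier \<Omega>. kaehler_lift MA \<delta> X)"

context
  fixes \<delta>
  assumes \<delta>: "partial_derivation F A D M \<delta>"
begin

lemma derivation_MA: "derivation F A MA \<delta>"
  using \<delta> by (simp add: partial_derivation_def)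

lemmas lift_facts =
  lift_closed[OF left_module_MA derivation_MA, unfolded MA_simps]
  lift_add[OF left_module_MA derivation_MA, unfolded MA_simps]
  lift_smult[OF left_module_MA derivation_MA, unfolded MA_simps]

lemma lift_apply_d: "a \<in> carrier A \<Longrightarrow> lift \<delta> (d a) = \<delta> a"
  using lift_d[OF left_module_MA derivation_MA] by (simp add: lift_def)

text \<open>Both sides are additive in \<open>X\<close>, so elements \<open>a db\<close> suffice;
  there both equal \<open>(\<partial>a) \<delta>b + a \<partial>(\<delta>b)\<close>.\<close>

lemma lift_partial:
  assumes "X \<in> carrier K"
  shows "kaehler_lift MA \<delta> (Q X) = del (kaehler_lift MA \<delta> X)"
  using assms
proof (induction X rule: K_induct)
  case zero
  have "kaehler_lift MA \<delta> \<zero>\<^bsub>K\<^esub> = \<zero>\<^bsub>M\<^esub>"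
    by (rule abelian_group_hom.hom_zero[of K M])
       (rule abelian_group_hom_additiveI, rule abelian_group_K, rule M.M.abelian_group_axioms,
        rule lift_facts(1), assumption, rule lift_facts(2))
  then show ?case
    by (simp only: abelian_group_hom.hom_zero[OF dm.Q_hom]
        M.smult_r_null[OF monom_Ops_closed[OF A.one_closed]])
next
  case (gen a b)
  have \<delta>b: "\<delta> b \<in> carrier M"
    using gen \<delta> by (auto simp: partial_derivation_iff)
  note ld = lift_d[OF left_module_MA derivation_MA]
  have "kaehler_lift MA \<delta> (Q (a \<odot>\<^bsub>K\<^esub> d b)) =
      kaehler_lift MA \<delta> (D a \<odot>\<^bsub>K\<^esub> d b \<oplus>\<^bsub>K\<^esub> a \<odot>\<^bsub>K\<^esub> d (D b))"
    using gen by (simp only: dm.Q_smult d_closed Q_d)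
  also have "\<dots> = D a \<bullet> \<delta> b \<oplus>\<^bsub>M\<^esub> a \<bullet> \<delta> (D b)"
    using gen by (simp only: lift_facts ld dm.K.smult_closed d_closed D_closed)
  \<comment> \<open>Here the commutation of \<delta> with \<partial> enters.\<close>
  also have "\<delta> (D b) = del (\<delta> b)"
    using gen \<delta> by (auto simp only: partial_derivation_iff)
  also have "D a \<bullet> \<delta> b \<oplus>\<^bsub>M\<^esub> a \<bullet> del (\<delta> b) = del (a \<bullet> \<delta> b)"
    by (rule partial_smult[OF left_module_M gen(1) \<delta>b, symmetric])
  also have "a \<bullet> \<delta> b = kaehler_lift MA \<delta> (a \<odot>\<^bsub>K\<^esub> d b)"
    using gen by (simp only: lift_facts ld d_closed)
  finally show ?case .
next
  case (add X Y)
  then show ?case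
    by (simp only: dm.Q_add lift_facts dm.Q_closed del_add)
qed

lemma lift_hom: "left_module_hom Ops \<Omega> M (lift \<delta>)"
  unfolding Omega_eq
  by (rule dm.left_module_hom_ActI[OF left_module_M])
     (simp_all only: lift_def Omega_simps restrict_apply' lift_facts lift_partial
       dm.Q_closed dm.K.smult_closed dm.K.M.a_closed)

end

section \<open>Homomorphisms out of \<Omega>(A)\<close>

lemma hom_facts:
  assumes "left_module_hom Ops \<Omega> M \<phi>"
  shows "X \<in> carrier K \<Longrightarrow> \<phi> X \<in> carrier M"
    and "\<lbrakk>X \<in> carrier K; Y \<in> carrier K\<rbrakk> \<Longrightarrow> \<phi> (X \<oplus>\<^bsub>K\<^esub> Y) = \<phi> X \<oplus>\<^bsub>M\<^esub> \<phi> Y"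
    and "\<lbrakk>p \<in> carrier Ops; X \<in> carrier K\<rbrakk> \<Longrightarrow> \<phi> (p \<odot>\<^bsub>\<Omega>\<^esub> X) = p \<odot>\<^bsub>M\<^esub> \<phi> X"
    and "\<lbrakk>a \<in> carrier A; X \<in> carrier K\<rbrakk> \<Longrightarrow> \<phi> (a \<odot>\<^bsub>K\<^esub> X) = a \<bullet> \<phi> X"
    and "X \<in> carrier K \<Longrightarrow> \<phi> (Q X) = del (\<phi> X)"
    and "\<phi> \<zero>\<^bsub>K\<^esub> = \<zero>\<^bsub>M\<^esub>"
proof -
  interpret \<phi>: left_module_hom Ops \<Omega> M \<phi> by fact
  show 1: "\<phi> X \<in> carrier M" if "X \<in> carrier K" for X
    using that \<phi>.hom_closed by auto
  show 2: "\<phi> (X \<oplus>\<^bsub>K\<^esub> Y) = \<phi> X \<oplus>\<^bsub>M\<^esub> \<phi> Y" if "X \<in> carrier K" "Y \<in> carrier K" for X Y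
    using that \<phi>.hom_add by (simp only: Omega_simps)
  show 3: "\<phi> (p \<odot>\<^bsub>\<Omega>\<^esub> X) = p \<odot>\<^bsub>M\<^esub> \<phi> X" if "p \<in> carrier Ops" "X \<in> carrier K" for p X
    using that \<phi>.hom_smult by (simp only: Omega_simps)
  show "\<phi> (a \<odot>\<^bsub>K\<^esub> X) = a \<bullet> \<phi> X" if "a \<in> carrier A" "X \<in> carrier K"
    using 3[OF monom_Ops_closed[OF that(1)] that(2), of 0] Omega_const[OF that] by (simp only:)
  show "\<phi> (Q X) = del (\<phi> X)" if "X \<in> carrier K"
    using 3[OF monom_Ops_closed[OF A.one_closed] that, of 1] Omega_partial[OF that] by (simp only:)
  show "\<phi> \<zero>\<^bsub>K\<^esub> = \<zero>\<^bsub>M\<^esub>"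
    by (rule abelian_group_hom.hom_zero[of K M])
       (rule abelian_group_hom_additiveI, rule abelian_group_K, rule M.M.abelian_group_axioms,
        rule 1, assumption, rule 2)
qed

text \<open>\<open>A\<close>-linearity extends agreement on \<open>d a\<close> to the spanning
  elements \<open>a db\<close>, and additivity to all of \<Omega>(A); extensionality settles the
  values off the carrier.\<close>

lemma hom_unique:
  assumes \<phi>: "left_module_hom Ops \<Omega> M \<phi>" "\<phi> \<in> extensional (carrier \<Omega>)"
    and \<psi>: "left_module_hom Ops \<Omega> M \<psi>" "\<psi> \<in> extensional (carrier \<Omega>)"
    and eq: "\<And>a. a \<in> carrier A \<Longrightarrow> \<phi> (d a) = \<psi> (d a)"
  shows "\<phi> = \<psi>"
proof (rule extensionalityI[OF \<phi>(2) \<psi>(2)])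
  fix X assume "X \<in> carrier \<Omega>"
  then have "X \<in> carrier K"
    by simp
  then show "\<phi> X = \<psi> X"
    by (induction X rule: K_induct)
       (simp_all only: hom_facts[OF \<phi>(1)] hom_facts[OF \<psi>(1)] d_closed eq)
qed

text \<open>\<phi> carries each law of \<open>d\<close> over to \<open>M\<close>, and
  \<open>Q (d a) = d (D a)\<close> turns compatibility of \<phi> with \<partial> into that of
  \<open>\<phi> \<circ> d\<close>.\<close>

lemma hom_partial_derivation:
  assumes \<phi>: "left_module_hom Ops \<Omega> M \<phi>"
  shows "partial_derivation F A D M (\<lambda>a\<in>carrier A. \<phi> (d a))"
  unfolding partial_derivation_iff
  by (intro conjI ballI funcsetI)
     (simp_all only: restrict_apply' hom_facts[OF \<phi>] d_closed d_add d_scalar d_mult Q_d[symmetric]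
       scalar_closed D_closed A.a_closed A.m_closed A.one_closed dm.K.smult_closed)

section \<open>\<open>Der\<close> and \<open>Hom\<close> as vector spaces over
  \<open>F\<close>\<close>

lemma Der_eq:
  "Der F A D M = function_module {\<delta>. partial_derivation F A D M \<delta>} (carrier A) MF"
  by (simp add: Der_def)

lemma Hom_eq:
  "Hom A D \<Omega> M = function_module {\<phi>. left_module_hom Ops \<Omega> M \<phi>} (carrier \<Omega>) MF"
  by (simp add: Hom_def)

lemma left_module_Der: "left_module F (Der F A D M)"
  unfolding Der_eq
proof (rule left_module.function_module_left_module[OF left_module_MF])
  show "{\<delta>. partial_derivation F A D M \<delta>} \<subseteq> carrier A \<rightarrow> carrier MF"
    by (auto simp: partial_derivation_iff)
  show "(\<lambda>x\<in>carrier A. \<zero>\<^bsub>MF\<^esub>) \<in> {\<delta>. partial_derivation F A D M \<delta>}"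
    unfolding partial_derivation_iff mem_Collect_eq
    by (intro conjI ballI funcsetI)
       (simp_all only: restrict_apply' MF_simps M.smult_r_null[OF monom_Ops_closed] M.M.zero_closed
         M.M.r_zero scalar_closed D_closed A.a_closed A.m_closed A.one_closed)
next
  fix \<delta> \<epsilon>
  assume "\<delta> \<in> {\<delta>. partial_derivation F A D M \<delta>}" "\<epsilon> \<in> {\<delta>. partial_derivation F A D M \<delta>}"
  then have \<delta>: "partial_derivation F A D M \<delta>" and \<epsilon>: "partial_derivation F A D M \<epsilon>"
    by simp_all
  note D = \<delta>[unfolded partial_derivation_iff] \<epsilon>[unfolded partial_derivation_iff]
  have closed: "\<delta> a \<in> carrier M" "\<epsilon> a \<in> carrier M" if "a \<in> carrier A" for a
    using D that by auto
  show "(\<lambda>x\<in>carrier A. \<delta> x \<oplus>\<^bsub>MF\<^esub> \<epsilon> x) \<in> {\<delta>. partial_derivation F A D M \<delta>}"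
    unfolding partial_derivation_iff mem_Collect_eq
    by (intro conjI ballI funcsetI)
       (simp_all only: restrict_apply' MF_simps D closed act_closed del_closed act_add del_add
         M.M.a_closed M.M.a_ac scalar_closed D_closed A.a_closed A.m_closed A.one_closed)
next
  fix c \<delta>
  assume c: "c \<in> carrier F" and "\<delta> \<in> {\<delta>. partial_derivation F A D M \<delta>}"
  then have \<delta>: "partial_derivation F A D M \<delta>"
    by simp
  note D = \<delta>[unfolded partial_derivation_iff]
  have closed: "\<delta> a \<in> carrier M" if "a \<in> carrier A" for a
    using D that by auto
  \<comment> \<open>\<open>scalar_commutes\<close> moves \<open>c\<close> past the constants of
    \<open>A\<close> and past \<partial> in the defining laws.\<close>
  show "(\<lambda>x\<in>carrier A. c \<odot>\<^bsub>MF\<^esub> \<delta> x) \<in> {\<delta>. partial_derivation F A D M \<delta>}"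
    unfolding partial_derivation_iff mem_Collect_eq
    by (intro conjI ballI funcsetI)
       (simp_all only: restrict_apply' MF_simps D closed act_closed del_closed act_add
         scalar_commutes[OF c monom_Ops_closed] c
         scalar_closed D_closed A.a_closed A.m_closed A.one_closed)
qed

lemma left_module_Hom: "left_module F (Hom A D \<Omega> M)"
  unfolding Hom_eq
proof (rule left_module.function_module_left_module[OF left_module_MF])
  show "{\<phi>. left_module_hom Ops \<Omega> M \<phi>} \<subseteq> carrier \<Omega> \<rightarrow> carrier MF"
    by (auto simp: hom_facts)
  note closed = left_module.smult_closed[OF left_module_Omega, unfolded Omega_simps]
  show "(\<lambda>x\<in>carrier \<Omega>. \<zero>\<^bsub>MF\<^esub>) \<in> {\<phi>. left_module_hom Ops \<Omega> M \<phi>}"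
    unfolding mem_Collect_eq
    by (rule left_module_homI[OF left_module_Omega left_module_M])
       (simp_all only: restrict_apply' MF_simps Omega_simps closed M.smult_r_null M.M.zero_closed
         M.M.r_zero dm.K.M.a_closed)
next
  note closed = left_module.smult_closed[OF left_module_Omega, unfolded Omega_simps]
  fix \<phi> \<psi>
  assume "\<phi> \<in> {\<phi>. left_module_hom Ops \<Omega> M \<phi>}" "\<psi> \<in> {\<phi>. left_module_hom Ops \<Omega> M \<phi>}"
  then have \<phi>: "left_module_hom Ops \<Omega> M \<phi>" and \<psi>: "left_module_hom Ops \<Omega> M \<psi>"
    by simp_all
  note hf = hom_facts(1-3)[OF \<phi>] hom_facts(1-3)[OF \<psi>]
  show "(\<lambda>x\<in>carrier \<Omega>. \<phi> x \<oplus>\<^bsub>MF\<^esub> \<psi> x) \<in> {\<phi>. left_module_hom Ops \<Omega> M \<phi>}"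
    unfolding mem_Collect_eq
    by (rule left_module_homI[OF left_module_Omega left_module_M])
       (simp_all only: restrict_apply' MF_simps Omega_simps closed hf M.smult_r_distr
         M.M.a_closed M.M.a_ac dm.K.M.a_closed)
next
  note closed = left_module.smult_closed[OF left_module_Omega, unfolded Omega_simps]
  fix c \<phi>
  assume c: "c \<in> carrier F" and "\<phi> \<in> {\<phi>. left_module_hom Ops \<Omega> M \<phi>}"
  then have \<phi>: "left_module_hom Ops \<Omega> M \<phi>"
    by simp
  note hf = hom_facts(1-3)[OF \<phi>]
  \<comment> \<open>A scalar multiple stays \<open>A[\<partial>]\<close>-linear because
    \<open>c\<close> commutes with every operator.\<close>
  show "(\<lambda>x\<in>carrier \<Omega>. c \<odot>\<^bsub>MF\<^esub> \<phi> x) \<in> {\<phi>. left_module_hom Ops \<Omega> M \<phi>}"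
    unfolding mem_Collect_eq
    by (rule left_module_homI[OF left_module_Omega left_module_M])
       (simp_all only: restrict_apply' MF_simps Omega_simps closed hf scalar_commutes[OF c]
         act_closed act_add scalar_closed[OF c] A.one_closed dm.K.M.a_closed)
qed

section \<open>The bijection between derivations and homomorphisms\<close>

lemma lift_extensional: "lift \<delta> \<in> extensional (carrier \<Omega>)"
  by (simp add: lift_def)

lemma Der_carrier:
  "\<delta> \<in> carrier (Der F A D M) \<longleftrightarrow> partial_derivation F A D M \<delta> \<and> \<delta> \<in> extensional (carrier A)"
  by (simp add: Der_eq)

lemma Hom_carrier:
  "\<phi> \<in> carrier (Hom A D \<Omega> M) \<longleftrightarrow> left_module_hom Ops \<Omega> M \<phi> \<and> \<phi> \<in> extensional (carrier \<Omega>)"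
  by (simp add: Hom_eq)

text \<open>Homomorphisms are determined by their values on the \<open>d a\<close>, so linearity and
  surjectivity of \<open>lift\<close> are checked after composing with \<open>d\<close>; injectivity
  holds because \<open>lift \<delta>\<close> returns the values of \<delta> there.\<close>

lemma lift_iso: "left_module_iso F (Der F A D M) (Hom A D \<Omega> M) lift"
proof (intro left_module_iso.intro left_module_iso_axioms.intro
    left_module_homI[OF left_module_Der left_module_Hom])
  interpret Der: left_module F "Der F A D M" by (rule left_module_Der)
  interpret Hom: left_module F "Hom A D \<Omega> M" by (rule left_module_Hom)
  have ld: "lift \<delta> (d a) = \<delta> a" if "\<delta> \<in> carrier (Der F A D M)" "a \<in> carrier A" for \<delta> a
    using that by (simp add: Der_carrier lift_apply_d)
  show closed: "lift \<delta> \<in> carrier (Hom A D \<Omega> M)" if "\<delta> \<in> carrier (Der F A D M)" for \<delta>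
    using that lift_hom lift_extensional unfolding Der_carrier Hom_carrier by blast
  have unique: "\<phi> = \<psi>"
    if "\<phi> \<in> carrier (Hom A D \<Omega> M)" "\<psi> \<in> carrier (Hom A D \<Omega> M)"
      "\<And>a. a \<in> carrier A \<Longrightarrow> \<phi> (d a) = \<psi> (d a)" for \<phi> \<psi>
    using that hom_unique by (simp add: Hom_carrier)
  show "lift (\<delta> \<oplus>\<^bsub>Der F A D M\<^esub> \<epsilon>) = lift \<delta> \<oplus>\<^bsub>Hom A D \<Omega> M\<^esub> lift \<epsilon>"
    if \<delta>: "\<delta> \<in> carrier (Der F A D M)" and \<epsilon>: "\<epsilon> \<in> carrier (Der F A D M)" for \<delta> \<epsilon>
  proof (rule unique)
    fix a assume a: "a \<in> carrier A"
    then show "lift (\<delta> \<oplus>\<^bsub>Der F A D M\<^esub> \<epsilon>) (d a) = (lift \<delta> \<oplus>\<^bsub>Hom A D \<Omega> M\<^esub> lift \<epsilon>) (d a)"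
      unfolding ld[OF Der.M.a_closed[OF \<delta> \<epsilon>] a]
      by (simp add: Der_eq Hom_eq ld[OF \<delta> a] ld[OF \<epsilon> a])
  qed (intro closed Der.M.a_closed Hom.M.a_closed \<delta> \<epsilon>)+
  show "lift (c \<odot>\<^bsub>Der F A D M\<^esub> \<delta>) = c \<odot>\<^bsub>Hom A D \<Omega> M\<^esub> lift \<delta>"
    if c: "c \<in> carrier F" and \<delta>: "\<delta> \<in> carrier (Der F A D M)" for c \<delta>
  proof (rule unique)
    fix a assume a: "a \<in> carrier A"
    then show "lift (c \<odot>\<^bsub>Der F A D M\<^esub> \<delta>) (d a) = (c \<odot>\<^bsub>Hom A D \<Omega> M\<^esub> lift \<delta>) (d a)"
      unfolding ld[OF Der.smult_closed[OF c \<delta>] a]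
      by (simp add: Der_eq Hom_eq ld[OF \<delta> a] del: Ops_simps)
  qed (intro closed Der.smult_closed Hom.smult_closed c \<delta>)+
  show "bij_betw lift (carrier (Der F A D M)) (carrier (Hom A D \<Omega> M))"
  proof (rule bij_betw_imageI)
    show "inj_on lift (carrier (Der F A D M))"
    proof (rule inj_onI)
      fix \<delta> \<epsilon> assume \<delta>: "\<delta> \<in> carrier (Der F A D M)" and \<epsilon>: "\<epsilon> \<in> carrier (Der F A D M)"
        and eq: "lift \<delta> = lift \<epsilon>"
      show "\<delta> = \<epsilon>"
      proof (rule extensionalityI[of _ "carrier A"])
        show "\<delta> a = \<epsilon> a" if "a \<in> carrier A" for a
          using ld[OF \<delta> that] ld[OF \<epsilon> that] eq by simp
      qed (use \<delta> \<epsilon> in \<open>simp_all add: Der_carrier\<close>)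
    qed
    have "\<phi> \<in> lift ` carrier (Der F A D M)" if \<phi>: "\<phi> \<in> carrier (Hom A D \<Omega> M)" for \<phi>
    proof
      \<comment> \<open>The inverse \<open>\<phi> \<mapsto> \<phi> \<circ> d\<close>, restricted to
        \<open>carrier A\<close> because elements of \<open>Der\<close> are extensional.\<close>
      let ?\<delta> = "\<lambda>a\<in>carrier A. \<phi> (d a)"
      show \<delta>: "?\<delta> \<in> carrier (Der F A D M)"
        using \<phi> hom_partial_derivation by (simp add: Der_carrier Hom_carrier)
      show "\<phi> = lift ?\<delta>"
        by (rule unique[OF \<phi> closed[OF \<delta>]]) (simp add: ld[OF \<delta>])
    qed
    then show "lift ` carrier (Der F A D M) = carrier (Hom A D \<Omega> M)"
      using closed by blast
  qed
qed

text \<open>Existence is \<open>lift\<close> and uniqueness is \<open>hom_unique\<close>. Uniqueness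
  is claimed among extensional maps, since values off the carrier of \<Omega>(A) would otherwise be
  arbitrary.\<close>

lemma universal:
  assumes \<delta>: "partial_derivation F A D M \<delta>"
  shows "\<exists>!\<phi>. \<phi> \<in> extensional (carrier \<Omega>) \<and> left_module_hom Ops \<Omega> M \<phi> \<and>
    (\<forall>a\<in>carrier A. \<phi> (d a) = \<delta> a)"
proof (rule ex1I[where a = "lift \<delta>"])
  show "lift \<delta> \<in> extensional (carrier \<Omega>) \<and> left_module_hom Ops \<Omega> M (lift \<delta>) \<and>
      (\<forall>a\<in>carrier A. lift \<delta> (d a) = \<delta> a)"
    using lift_apply_d[OF \<delta>] lift_hom[OF \<delta>] lift_extensional by blast
next
  fix \<phi>
  assume \<phi>: "\<phi> \<in> extensional (carrier \<Omega>) \<and> left_module_hom Ops \<Omega> M \<phi> \<and>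
    (\<forall>a\<in>carrier A. \<phi> (d a) = \<delta> a)"
  show "\<phi> = lift \<delta>"
    by (rule hom_unique) (use \<phi> lift_apply_d[OF \<delta>] lift_hom[OF \<delta>] lift_extensional in auto)
qed

end

text \<open>Over the regular module, \<open>derivation\<close> expresses a scalar as multiplication
  by \<open>c \<odot> \<one>\<close>; compatibility of the scalar action with the product of
  \<open>A\<close> turns this into scalar multiplication by \<open>c\<close>.\<close>

lemma differential_algebra_imp_algebra_derivation:
  assumes "differential_algebra F A D"
  shows "algebra_derivation F A D"
proof -
  interpret differential_algebra F A D by fact
  have alg: "algebra F A"
    by (rule A.algebra_axioms)
  have der: "derivation F A (regular_module A) D"
    by (rule D_derivation)
  have cring: "cring A"
    by (rule algebra.M_cring[OF alg])
  show ?thesis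
  proof (intro algebra_derivation.intro differential_cring.intro cring alg
      differential_cring_axioms.intro algebra_derivation_axioms.intro)
    fix c a assume c: "c \<in> carrier F" and a: "a \<in> carrier A"
    have Da: "D a \<in> carrier A"
      using der a by (auto simp: derivation_def regular_module_def)
    have "D (c \<odot>\<^bsub>A\<^esub> a) = (c \<odot>\<^bsub>A\<^esub> \<one>\<^bsub>A\<^esub>) \<otimes>\<^bsub>A\<^esub> D a"
      using der c a by (auto simp: derivation_def regular_module_def)
    also have "\<dots> = c \<odot>\<^bsub>A\<^esub> (\<one>\<^bsub>A\<^esub> \<otimes>\<^bsub>A\<^esub> D a)"
      by (rule algebra.smult_assoc2[OF alg c monoid.one_closed[OF ring.is_monoid[OF cring.axioms(1)[OF cring]]] Da])
    also have "\<one>\<^bsub>A\<^esub> \<otimes>\<^bsub>A\<^esub> D a = D a"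
      by (rule monoid.l_one[OF ring.is_monoid[OF cring.axioms(1)[OF cring]] Da])
    finally show "D (c \<odot>\<^bsub>A\<^esub> a) = c \<odot>\<^bsub>A\<^esub> D a" .
  qed (use der in \<open>auto simp: derivation_def regular_module_def\<close>)
qed

theorem proposition4p4:
  fixes F :: "('f, 'x) ring_scheme"
    and A :: "('f, 'a, 'y) module_scheme"
    and D :: "'a \<Rightarrow> 'a"
    and M :: "(nat \<Rightarrow> 'a, 'm, 'z) module_scheme"
  assumes "differential_algebra F A D"
    and "left_module (diff_ops A D) M"
  shows "(\<forall>\<delta>. partial_derivation F A D M \<delta> \<longrightarrow>
            (\<exists>!\<phi>. \<phi> \<in> extensional (carrier (Omega F A D)) \<and>
                  left_module_hom (diff_ops A D) (Omega F A D) M \<phi> \<and>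
                  (\<forall>a\<in>carrier A. \<phi> (kaehler_d F A a) = \<delta> a))) \<and>
         (\<exists>\<Psi>. left_module_iso F (Der F A D M) (Hom A D (Omega F A D) M) \<Psi> \<and>
            (\<forall>\<delta>\<in>carrier (Der F A D M). \<forall>a\<in>carrier A. \<Psi> \<delta> (kaehler_d F A a) = \<delta> a))"
proof -
  interpret kaehler_universal F A D M
    by (intro kaehler_universal.intro differential_algebra_imp_algebra_derivation assms)
  show ?thesis
    using universal lift_iso lift_apply_d by (auto simp: Der_carrier)
qed

end
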